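(* Fix $a\in[0,1]$ and an integer $k\ge 0$. Let $(X,f)$ and $(Y,g)$ be set-function pairs (so $f:X\times X\to\mathbb{R}$ and $g:Y\times Y\to\mathbb{R}$ are arbitrary, not necessarily symmetric, functions) such that $d_{CD}((X,f),(Y,g))$ is finite. Let $P^X$ and $P^Y$ be the $k$-th dimensional homology persistence modules of the Rips filtrations $\mathcal{R}(X,\operatorname{sym}_a(f))$ and $\mathcal{R}(Y,\operatorname{sym}_a(g))$ respectively. Then $$d_{int}(P^X,P^Y)\le 2\,d_{CD}\big((X,\operatorname{sym}_a(f)),(Y,\operatorname{sym}_a(g))\big).$$
   Context: Fix a field $\mathbb{F}$; all homology is with coefficients in $\mathbb{F}$. A set-function pair $(X,f)$ is a set $X$ with a function $f:X\times X\to\mathbb{R}$. A correspondence between $X$ and $Y$ is a subset $\mathcal{M}\subset X\times Y$ such that every $x\in X$ has some $y\in Y$ with $(x,y)\in\mathcal{M}$ and every $y\in Y$ has some $x\in X$ with $(x,y)\in\mathcal{M}$. Its distortion is $dis_{(X,f),(Y,g)}(\mathcal{M})=\sup_{(x_1,y_1),(x_2,y_2)\in\mathcal{M}}|f(x_1,x_2)-g(y_1,y_2)|$. The correspondence distortion distance is $d_{CD}((X,f),(Y,g))=\frac12\inf_{\mathcal{M}}dis_{(X,f),(Y,g)}(\mathcal{M})\in[0,\infty]$, the infimum over all correspondences between $X$ and $Y$. For $f:X\times X\to\mathbb{R}$ and $a\in[0,1]$, $\operatorname{sym}_a(f):X\times X\to\mathbb{R}$ is the symmetric function $\operatorname{sym}_a(f)(x,y)=a\min\{f(x,y),f(y,x)\}+(1-a)\max\{f(x,y),f(y,x)\}$.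 For a symmetric function $h:X\times X\to\mathbb{R}$, the Rips filtration $\mathcal{R}(X,h)=\{\mathcal{R}(X,h)_t\}_{t\in\mathbb{R}}$ is the family of abstract simplicial complexes in which a (finite, nonempty) simplex $[x_0,\dots,x_p]$ belongs to $\mathcal{R}(X,h)_t$ iff $h(x_i,x_j)\le t$ for all $i,j$ (including $i=j$). Its $k$-th homology persistence module is $\{H_k(\mathcal{R}(X,h)_t)\}_{t\in\mathbb{R}}$ with the maps induced by inclusions. A persistence module is a family $\{P_t\}_{t\in\mathbb{R}}$ of $\mathbb{F}$-vector spaces with linear maps $\iota_t^s:P_t\to P_s$ for $t\le s$ such that $\iota_t^t=\mathrm{id}$ and $\iota_t^r=\iota_s^r\circ\iota_t^s$ for $t\le s\le r$. Persistence modules $P^X,P^Y$ are $\epsilon$-interleaved if there are families of linear maps $\alpha_t:P^X_t\to P^Y_{t+\epsilon}$ and $\beta_t:P^Y_t\to P^X_{t+\epsilon}$ ($t\in\mathbb{R}$) that commute with the structure maps ($\alpha_{t'}\circ\iota_t^{t'}=\iota_{t+\epsilon}^{t'+\epsilon}\circ\alpha_t$ and $\beta_{t'}\circ\iota_t^{t'}=\iota_{t+\epsilon}^{t'+\epsilon}\circ\beta_t$ for $t\le t'$) and satisfy $\beta_{t+\epsilon}\circ\alpha_t=\iota_t^{t+2\epsilon}$ and $\alpha_{t+\epsilon}\circ\beta_t=\iota_t^{t+2\epsilon}$ for all $t$. The interleaving distance $d_{int}(P^X,P^Y)\in[0,\infty]$ is the infimum of all $\epsilon>0$ such that $P^X,P^Y$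 are $\epsilon$-interleaved. *)

theory Defs
  imports
    "HOL-Combinatorics.Permutations"
    "HOL-Library.Extended_Nonnegative_Real"
    "HOL-Algebra.AbelCoset"
    "Jordan_Normal_Form.VS_Connect"
begin

text \<open>
  The coefficient field is a type \<open>'f\<close> of class \<^class>\<open>field\<close>. Vector spaces over it are
  \<open>module\<close> records \<open>V\<close> satisfying \<open>vectorspace class_ring V\<close>, where \<^term>\<open>class_ring\<close> is the ring
  record of a type.
\<close>


section \<open>Set-function pairs\<close>

definition correspondences :: "'x set \<Rightarrow> 'y set \<Rightarrow> ('x \<times> 'y) set set" where
  "correspondences X Y =
     {M. M \<subseteq> X \<times> Y \<and> (\<forall>x\<in>X. \<exists>y\<in>Y. (x, y) \<in> M) \<and> (\<forall>y\<in>Y. \<exists>x\<in>X. (x, y) \<in> M)}"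

text \<open>
  Taking values in \<^typ>\<open>ennreal\<close> makes the supremum over the empty correspondence \<open>0\<close> and the
  infimum over an empty set of correspondences \<open>\<infinity>\<close>.
\<close>

definition distortion ::
    "('x \<Rightarrow> 'x \<Rightarrow> real) \<Rightarrow> ('y \<Rightarrow> 'y \<Rightarrow> real) \<Rightarrow> ('x \<times> 'y) set \<Rightarrow> ennreal" where
  "distortion f g M = (SUP (x1, y1) \<in> M. SUP (x2, y2) \<in> M. ennreal \<bar>f x1 x2 - g y1 y2\<bar>)"

definition d_CD ::
    "'x set \<Rightarrow> ('x \<Rightarrow> 'x \<Rightarrow> real) \<Rightarrow> 'y set \<Rightarrow> ('y \<Rightarrow> 'y \<Rightarrow> real) \<Rightarrow> ennreal" where
  "d_CD X f Y g = (INF M \<in> correspondences X Y. distortion f g M) / 2"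

definition symmetrize :: "real \<Rightarrow> ('x \<Rightarrow> 'x \<Rightarrow> real) \<Rightarrow> 'x \<Rightarrow> 'x \<Rightarrow> real" where
  "symmetrize a f x y = a * min (f x y) (f y x) + (1 - a) * max (f x y) (f y x)"

definition rips :: "'x set \<Rightarrow> ('x \<Rightarrow> 'x \<Rightarrow> real) \<Rightarrow> real \<Rightarrow> 'x set set" where
  "rips X h t = {\<sigma>. finite \<sigma> \<and> \<sigma> \<noteq> {} \<and> \<sigma> \<subseteq> X \<and> (\<forall>x\<in>\<sigma>. \<forall>y\<in>\<sigma>. h x y \<le> t)}"


section \<open>Simplicial homology\<close>

definition simplicial_complex :: "'x set set \<Rightarrow> bool" where
  "simplicial_complex K \<longleftrightarrow>
     (\<forall>\<sigma>\<in>K. finite \<sigma> \<and> \<sigma> \<noteq> {} \<and> (\<forall>\<tau>\<subseteq>\<sigma>. \<tau> \<noteq> {} \<longrightarrow> \<tau> \<in> K))"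

text \<open>
  Oriented simplicial chains: a \<open>p\<close>-chain is a finitely supported function on the orderings
  \<open>[x\<^sub>0, \<dots>, x\<^sub>p]\<close> of the \<open>p\<close>-simplices of \<open>K\<close> that changes by the sign of the permutation under
  reordering. It is extended by \<open>0\<close> to all lists, so that the chains of a subcomplex literally are
  chains of the larger complex.
\<close>

definition simplicial_chains :: "nat \<Rightarrow> 'x set set \<Rightarrow> ('x list \<Rightarrow> 'f::field) set" where
  "simplicial_chains p K =
     {c. finite {xs. c xs \<noteq> 0} \<and>
         (\<forall>xs. c xs \<noteq> 0 \<longrightarrow> length xs = Suc p \<and> distinct xs \<and> set xs \<in> K) \<and>
         (\<forall>xs \<pi>. \<pi> permutes {..<length xs} \<longrightarrow> c (permute_list \<pi> xs) = of_int (sign \<pi>) * c xs)}"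

text \<open>
  The boundary operator, written in terms of coefficients: \<open>[y\<^sub>1, \<dots>, y\<^sub>p]\<close> occurs in the boundary
  of \<open>[v, y\<^sub>1, \<dots>, y\<^sub>p]\<close> with sign \<open>+1\<close>. Lemma \<open>boundary_elementary_chain\<close> below
  recovers the formula \<open>\<partial>[x\<^sub>0, \<dots>, x\<^sub>p] = \<Sum>\<^sub>i (-1)\<^sup>i [x\<^sub>0, \<dots>, x\<^sub>i\<^sub>-\<^sub>1, x\<^sub>i\<^sub>+\<^sub>1, \<dots>, x\<^sub>p]\<close>,
  and lemma \<open>chain_eq_sum_elementary\<close> shows that the oriented simplices span the chains.
  The value at the empty list is \<open>0\<close> because homology is not reduced: \<open>\<partial>\<close> vanishes on \<open>0\<close>-chains.
\<close>

definition boundary :: "('x list \<Rightarrow> 'f::field) \<Rightarrow> 'x list \<Rightarrow> 'f" where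
  "boundary c ys = (if ys = [] then 0 else (\<Sum>v | c (v # ys) \<noteq> 0. c (v # ys)))"

definition chain_space :: "nat \<Rightarrow> 'x set set \<Rightarrow> ('f::field, 'x list \<Rightarrow> 'f) module" where
  "chain_space p K =
     \<lparr>carrier = simplicial_chains p K, mult = undefined, one = undefined,
      zero = (\<lambda>_. 0), add = (\<lambda>c d xs. c xs + d xs), smult = (\<lambda>a c xs. a * c xs)\<rparr>"

definition cycle_space :: "nat \<Rightarrow> 'x set set \<Rightarrow> ('f::field, 'x list \<Rightarrow> 'f) module" where
  "cycle_space p K =
     (chain_space p K)\<lparr>carrier := {c \<in> simplicial_chains p K. boundary c = (\<lambda>_. 0)}\<rparr>"

definition boundaries :: "nat \<Rightarrow> 'x set set \<Rightarrow> ('x list \<Rightarrow> 'f::field) set" where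
  "boundaries p K = boundary ` simplicial_chains (Suc p) K"

definition quotient_space :: "('f, 'v) module \<Rightarrow> 'v set \<Rightarrow> ('f, 'v set) module" where
  "quotient_space V W =
     \<lparr>carrier = a_rcosets\<^bsub>V\<^esub> W, mult = undefined, one = undefined,
      zero = W, add = set_add V, smult = (\<lambda>a C. \<Union>v\<in>C. W +>\<^bsub>V\<^esub> (a \<odot>\<^bsub>V\<^esub> v))\<rparr>"

definition homology :: "nat \<Rightarrow> 'x set set \<Rightarrow> ('f::field, ('x list \<Rightarrow> 'f) set) module" where
  "homology p K = quotient_space (cycle_space p K) (boundaries p K)"

text \<open>
  The map induced by the inclusion of a subcomplex into \<open>L\<close>, sending the class of a cycle
  to its class in the homology of \<open>L\<close> (lemma \<open>homology_inclusion_class\<close>).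
\<close>

definition homology_inclusion ::
    "nat \<Rightarrow> 'x set set \<Rightarrow> ('x list \<Rightarrow> 'f::field) set \<Rightarrow> ('x list \<Rightarrow> 'f) set" where
  "homology_inclusion p L C = (\<Union>c\<in>C. boundaries p L +>\<^bsub>cycle_space p L\<^esub> c)"


section \<open>Persistence modules\<close>

record ('f, 'v) persistence =
  pspace :: "real \<Rightarrow> ('f, 'v) module"
  pmap :: "real \<Rightarrow> real \<Rightarrow> 'v \<Rightarrow> 'v"

locale persistence_module =
  fixes P :: "('f::field, 'v) persistence"
  assumes pmap_linear: "t \<le> s \<Longrightarrow> linear_map class_ring (pspace P t) (pspace P s) (pmap P t s)"
    and pmap_refl: "v \<in> carrier (pspace P t) \<Longrightarrow> pmap P t t v = v"
    and pmap_trans: "\<lbrakk>t \<le> s; s \<le> r; v \<in> carrier (pspace P t)\<rbrakk>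
      \<Longrightarrow> pmap P t r v = pmap P s r (pmap P t s v)"

definition interleaving_maps ::
    "real \<Rightarrow> ('f::field, 'v) persistence \<Rightarrow> ('f, 'w) persistence \<Rightarrow>
     (real \<Rightarrow> 'v \<Rightarrow> 'w) \<Rightarrow> (real \<Rightarrow> 'w \<Rightarrow> 'v) \<Rightarrow> bool" where
  "interleaving_maps \<epsilon> P Q \<alpha> \<beta> \<longleftrightarrow>
     (\<forall>t. linear_map class_ring (pspace P t) (pspace Q (t + \<epsilon>)) (\<alpha> t)) \<and>
     (\<forall>t. linear_map class_ring (pspace Q t) (pspace P (t + \<epsilon>)) (\<beta> t)) \<and>
     (\<forall>t s. t \<le> s \<longrightarrow> (\<forall>v\<in>carrier (pspace P t).
        \<alpha> s (pmap P t s v) = pmap Q (t + \<epsilon>) (s + \<epsilon>) (\<alpha> t v))) \<and>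
     (\<forall>t s. t \<le> s \<longrightarrow> (\<forall>w\<in>carrier (pspace Q t).
        \<beta> s (pmap Q t s w) = pmap P (t + \<epsilon>) (s + \<epsilon>) (\<beta> t w))) \<and>
     (\<forall>t. \<forall>v\<in>carrier (pspace P t). \<beta> (t + \<epsilon>) (\<alpha> t v) = pmap P t (t + 2 * \<epsilon>) v) \<and>
     (\<forall>t. \<forall>w\<in>carrier (pspace Q t). \<alpha> (t + \<epsilon>) (\<beta> t w) = pmap Q t (t + 2 * \<epsilon>) w)"

definition interleaved ::
    "real \<Rightarrow> ('f::field, 'v) persistence \<Rightarrow> ('f, 'w) persistence \<Rightarrow> bool" where
  "interleaved \<epsilon> P Q \<longleftrightarrow> (\<exists>\<alpha> \<beta>. interleaving_maps \<epsilon> P Q \<alpha> \<beta>)"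

definition d_int :: "('f::field, 'v) persistence \<Rightarrow> ('f, 'w) persistence \<Rightarrow> ennreal" where
  "d_int P Q = (INF \<epsilon> \<in> {\<epsilon>. \<epsilon> > 0 \<and> interleaved \<epsilon> P Q}. ennreal \<epsilon>)"

definition rips_homology ::
    "nat \<Rightarrow> 'x set \<Rightarrow> ('x \<Rightarrow> 'x \<Rightarrow> real) \<Rightarrow> ('f::field, ('x list \<Rightarrow> 'f) set) persistence" where
  "rips_homology k X h =
     \<lparr>pspace = (\<lambda>t. homology k (rips X h t)),
      pmap = (\<lambda>t s. homology_inclusion k (rips X h s))\<rparr>"


section \<open>Properties of the boundary operator\<close>

lemma simplicial_chains_finite: "c \<in> simplicial_chains p K \<Longrightarrow> finite {xs. c xs \<noteq> 0}"
  by (simp add: simplicial_chains_def)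

lemma simplicial_chains_support:
  assumes "c \<in> simplicial_chains p K" "c xs \<noteq> 0"
  shows "length xs = Suc p" "distinct xs" "set xs \<in> K"
  using assms by (auto simp: simplicial_chains_def)

lemma simplicial_chains_permute:
  assumes "c \<in> simplicial_chains p K" "\<pi> permutes {..<length xs}"
  shows "c (permute_list \<pi> xs) = of_int (sign \<pi>) * c xs"
  using assms by (auto simp: simplicial_chains_def)

lemma simplicial_chains_mono: "K \<subseteq> L \<Longrightarrow> simplicial_chains p K \<subseteq> simplicial_chains p L"
  by (auto simp: simplicial_chains_def)

lemma simplicial_chains_zero: "(\<lambda>_. 0) \<in> simplicial_chains p K"
  by (auto simp: simplicial_chains_def)

lemma simplicial_chains_add:
  assumes "c \<in> simplicial_chains p K" "d \<in> simplicial_chains p K"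
  shows "(\<lambda>xs. c xs + d xs) \<in> simplicial_chains p K"
proof -
  have "finite {xs. c xs + d xs \<noteq> 0}"
    by (rule finite_subset[OF _ finite_UnI[OF assms[THEN simplicial_chains_finite]]]) auto
  moreover have "c xs \<noteq> 0 \<or> d xs \<noteq> 0" if "c xs + d xs \<noteq> 0" for xs
    using that by auto
  ultimately show ?thesis
    using assms unfolding simplicial_chains_def by (auto simp: distrib_left) (metis)+
qed

lemma simplicial_chains_smult:
  assumes "c \<in> simplicial_chains p K"
  shows "(\<lambda>xs. a * c xs) \<in> simplicial_chains p K"
proof -
  have "finite {xs. a * c xs \<noteq> 0}"
    by (rule finite_subset[OF _ assms[THEN simplicial_chains_finite]]) auto
  then show ?thesis
    using assms unfolding simplicial_chains_def by auto
qed

lemma finite_Cons_support: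
  assumes "finite {xs. c xs \<noteq> 0}"
  shows "finite {v. c (v # ys) \<noteq> 0}"
  by (rule finite_subset[OF _ finite_imageI[OF assms, of hd]]) force

lemma boundary_eq_sum:
  assumes "finite S" "{v. c (v # ys) \<noteq> 0} \<subseteq> S" "ys \<noteq> []"
  shows "boundary c ys = (\<Sum>v\<in>S. c (v # ys))"
  unfolding boundary_def using assms by (auto intro!: sum.mono_neutral_left)

lemma boundary_zero: "boundary (\<lambda>_. 0) = (\<lambda>_. 0)"
  by (rule ext) (simp add: boundary_def)

lemma boundary_add:
  assumes "finite {xs. c xs \<noteq> 0}" "finite {xs. d xs \<noteq> 0}"
  shows "boundary (\<lambda>xs. c xs + d xs) = (\<lambda>ys. boundary c ys + boundary d ys)"
proof
  fix ys
  show "boundary (\<lambda>xs. c xs + d xs) ys = boundary c ys + boundary d ys"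
  proof (cases "ys = []")
    case False
    let ?S = "{v. c (v # ys) \<noteq> 0} \<union> {v. d (v # ys) \<noteq> 0}"
    have "finite ?S"
      using assms by (simp add: finite_Cons_support)
    then have "boundary c ys = (\<Sum>v\<in>?S. c (v # ys))" "boundary d ys = (\<Sum>v\<in>?S. d (v # ys))"
      "boundary (\<lambda>xs. c xs + d xs) ys = (\<Sum>v\<in>?S. c (v # ys) + d (v # ys))"
      using False by (intro boundary_eq_sum; auto)+
    then show ?thesis
      by (simp add: sum.distrib)
  qed (simp add: boundary_def)
qed

lemma boundary_smult: "boundary (\<lambda>xs. a * c xs) = (\<lambda>ys. a * boundary c ys)"
  by (rule ext) (cases "a = 0"; simp add: boundary_def sum_distrib_left)

lemma chain_Cons_permute:
  assumes c: "c \<in> simplicial_chains p K" and \<pi>: "\<pi> permutes {..<length ys}"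
  shows "c (v # permute_list \<pi> ys) = of_int (sign \<pi>) * c (v # ys)"
proof -
  define \<rho> where "\<rho> = map_permutation {..<length ys} Suc \<pi>"
  have img: "Suc ` {..<length ys} = {1..<Suc (length ys)}"
    by (simp add: image_Suc_lessThan atLeastLessThanSuc_atLeastAtMost)
  have \<rho>: "\<rho> permutes {..<length (v # ys)}"
  proof (rule permutes_subset)
    show "\<rho> permutes {1..<Suc (length ys)}"
      unfolding \<rho>_def img[symmetric] by (rule map_permutation_permutes[OF _ \<pi>]) (simp add: bij_betw_def)
  qed auto
  have sgn: "sign \<rho> = sign \<pi>"
    unfolding \<rho>_def using \<pi> by (intro sign_map_permutation) auto
  have \<rho>0: "\<rho> 0 = 0"
    by (simp add: \<rho>_def map_permutation_def restrict_id_def)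
  have \<rho>S: "\<rho> (Suc i) = Suc (\<pi> i)" if "i < length ys" for i
    unfolding \<rho>_def using that by (intro map_permutation_apply) auto
  have "permute_list \<rho> (v # ys) = v # permute_list \<pi> ys"
    by (rule nth_equalityI) (auto simp: permute_list_def nth_Cons \<rho>0 \<rho>S simp del: upt_Suc split: nat.splits)
  then show ?thesis
    using simplicial_chains_permute[OF c \<rho>] sgn by simp
qed

lemma boundary_in_chains:
  assumes K: "simplicial_complex K" and c: "c \<in> simplicial_chains (Suc p) K"
  shows "boundary c \<in> simplicial_chains p K"
proof -
  have sup: "\<exists>v. c (v # ys) \<noteq> 0" "ys \<noteq> []" if "boundary c ys \<noteq> 0" for ys
    using that by (auto simp: boundary_def split: if_splits dest: sum.not_neutral_contains_not_neutral)
  have "{ys. boundary c ys \<noteq> 0} \<subseteq> tl ` {xs. c xs \<noteq> 0}"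
    using sup(1) by force
  then have "finite {ys. boundary c ys \<noteq> 0}"
    using simplicial_chains_finite[OF c] finite_surj by blast
  moreover have "length ys = Suc p \<and> distinct ys \<and> set ys \<in> K"
    if nz: "boundary c ys \<noteq> 0" for ys
  proof -
    obtain v where v: "c (v # ys) \<noteq> 0"
      using sup(1)[OF nz] by blast
    note * = simplicial_chains_support[OF c v]
    have "set ys \<subseteq> set (v # ys)" "set ys \<noteq> {}"
      using sup(2)[OF nz] by auto
    then have "set ys \<in> K"
      using K *(3) unfolding simplicial_complex_def by blast
    then show ?thesis
      using * by auto
  qed
  moreover have "boundary c (permute_list \<pi> ys) = of_int (sign \<pi>) * boundary c ys"
    if \<pi>: "\<pi> permutes {..<length ys}" for \<pi> ys
  proof (cases "ys = []")
    case False
    have ne: "permute_list \<pi> ys \<noteq> []"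
      using False by (metis length_permute_list length_0_conv)
    have "(of_int (sign \<pi>) :: 'b) \<noteq> 0"
      by (cases \<pi> rule: sign_cases) auto
    then show ?thesis
      using False ne by (simp add: boundary_def chain_Cons_permute[OF c \<pi>] sum_distrib_left)
  qed (simp add: boundary_def)
  ultimately show ?thesis
    by (simp add: simplicial_chains_def)
qed

lemma sum_antisymmetric:
  fixes d :: "'a \<Rightarrow> 'a \<Rightarrow> 'b::comm_ring_1"
  assumes "finite S" "\<And>v. d v v = 0" "\<And>v w. v \<noteq> w \<Longrightarrow> d v w = - d w v"
  shows "(\<Sum>v\<in>S. \<Sum>w\<in>S. d v w) = 0"
  using assms(1)
proof induction
  case (insert x S)
  have "(\<Sum>v\<in>S. d v x) = (\<Sum>v\<in>S. - d x v)"
    using insert.hyps by (intro sum.cong) (auto intro: assms(3))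
  with insert show ?case
    by (simp add: sum.distrib assms(2) sum_negf)
qed simp

lemma permute_list_transpose_01:
  "permute_list (transpose 0 (Suc 0)) (v # w # ys) = w # v # ys"
  by (rule nth_equalityI)
    (auto simp: permute_list_def nth_Cons transpose_def simp del: upt_Suc split: nat.splits)

lemma boundary_boundary:
  assumes c: "c \<in> simplicial_chains (Suc p) K"
  shows "boundary (boundary c) = (\<lambda>_. 0)"
proof
  fix ys
  show "boundary (boundary c) ys = 0"
  proof (cases "ys = []")
    case False
    define S where "S = \<Union>(set ` {xs. c xs \<noteq> 0})"
    have S: "finite S"
      using simplicial_chains_finite[OF c] by (auto simp: S_def)
    have in_S: "x \<in> S" if "c xs \<noteq> 0" "x \<in> set xs" for x xs
      using that by (auto simp: S_def)
    have eq: "boundary c (v # ys) = (\<Sum>w\<in>S. c (w # v # ys))" for v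
      using S in_S by (intro boundary_eq_sum) (auto simp: subset_iff)
    have "v \<in> S" if nz: "boundary c (v # ys) \<noteq> 0" for v
    proof -
      obtain w where "c (w # v # ys) \<noteq> 0"
        using nz unfolding eq by (meson sum.not_neutral_contains_not_neutral)
      then show ?thesis
        using in_S by auto
    qed
    then have "boundary (boundary c) ys = (\<Sum>v\<in>S. \<Sum>w\<in>S. c (w # v # ys))"
      using S False by (subst boundary_eq_sum[of S]) (auto simp: eq)
    also have "\<dots> = 0"
    proof (rule sum_antisymmetric[OF S])
      show "c (v # v # ys) = 0" for v
        using simplicial_chains_support(2)[OF c, of "v # v # ys"] by auto
      show "c (w # v # ys) = - c (v # w # ys)" for v w
        using simplicial_chains_permute[OF c, of "transpose 0 (Suc 0)" "v # w # ys"]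
        by (simp add: permute_list_transpose_01 sign_swap_id permutes_swap_id)
    qed
    finally show ?thesis .
  qed (simp add: boundary_def)
qed

text \<open>The oriented simplex \<open>[x\<^sub>0, \<dots>, x\<^sub>p]\<close>; it is \<open>0\<close> if two of its vertices coincide.\<close>

definition elementary_chain :: "'x list \<Rightarrow> 'x list \<Rightarrow> 'f::field" where
  "elementary_chain xs ys =
     (\<Sum>\<pi> | \<pi> permutes {..<length xs} \<and> permute_list \<pi> xs = ys. of_int (sign \<pi>))"

lemma elementary_chain_permute:
  assumes xs: "distinct xs" and \<pi>: "\<pi> permutes {..<length xs}"
  shows "elementary_chain xs (permute_list \<pi> xs) = of_int (sign \<pi>)"
proof -
  have "\<rho> = \<pi>" if "\<rho> permutes {..<length xs}" "permute_list \<rho> xs = permute_list \<pi> xs" for \<rho>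
  proof
    fix i
    show "\<rho> i = \<pi> i"
    proof (cases "i < length xs")
      case True
      then have "xs ! \<rho> i = xs ! \<pi> i"
        using that \<pi> by (metis permute_list_nth)
      then show ?thesis
        using xs True that(1) \<pi> by (metis nth_eq_iff_index_eq permutes_in_image lessThan_iff)
    qed (use that(1) \<pi> in \<open>auto simp: permutes_def\<close>)
  qed
  then have "{\<rho>. \<rho> permutes {..<length xs} \<and> permute_list \<rho> xs = permute_list \<pi> xs} = {\<pi>}"
    using \<pi> by auto
  then show ?thesis
    by (simp add: elementary_chain_def)
qed

lemma elementary_chain_outside:
  assumes "mset ys \<noteq> mset xs"
  shows "elementary_chain xs ys = 0"
  using assms by (auto simp: elementary_chain_def intro!: sum.neutral)

lemma elementary_chain_obtain:
  assumes "mset ys = mset xs"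
  obtains \<pi> where "\<pi> permutes {..<length xs}" "permute_list \<pi> xs = ys"
  using mset_eq_permutation[OF assms] by blast

lemma elementary_chain_in_chains:
  assumes xs: "distinct xs" "length xs = Suc p" "set xs \<in> K"
  shows "elementary_chain xs \<in> simplicial_chains p K"
proof -
  have sup: "mset ys = mset xs" if "elementary_chain xs ys \<noteq> 0" for ys
    using that elementary_chain_outside by metis
  have "{ys. elementary_chain xs ys \<noteq> 0} \<subseteq> (\<lambda>\<pi>. permute_list \<pi> xs) ` {\<pi>. \<pi> permutes {..<length xs}}"
    using elementary_chain_obtain[OF sup] by blast
  then have "finite {ys. elementary_chain xs ys \<noteq> 0}"
    by (rule finite_subset) (simp add: finite_permutations)
  moreover have "length ys = Suc p \<and> distinct ys \<and> set ys \<in> K" if "elementary_chain xs ys \<noteq> 0" for ys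
    using sup[OF that] xs by (metis mset_eq_imp_distinct_iff mset_eq_length mset_eq_setD)
  moreover have "elementary_chain xs (permute_list \<pi> ys) = of_int (sign \<pi>) * elementary_chain xs ys"
    if \<pi>: "\<pi> permutes {..<length ys}" for \<pi> ys
  proof (cases "mset ys = mset xs")
    case True
    then obtain \<rho> where \<rho>: "\<rho> permutes {..<length xs}" "permute_list \<rho> xs = ys"
      by (rule elementary_chain_obtain)
    have len: "length ys = length xs"
      using True by (rule mset_eq_length)
    have "permute_list \<pi> ys = permute_list (\<rho> \<circ> \<pi>) xs"
      using \<pi> \<rho> len by (metis permute_list_compose)
    moreover have "sign (\<rho> \<circ> \<pi>) = sign \<rho> * sign \<pi>"
      using \<pi> \<rho> len by (intro sign_compose) (auto intro: permutes_imp_permutation[rotated])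
    ultimately show ?thesis
      using elementary_chain_permute[OF xs(1)] \<pi> \<rho> len by (metis mult.commute of_int_mult permutes_compose)
  next
    case False
    then show ?thesis
      using \<pi> by (simp add: elementary_chain_outside)
  qed
  ultimately show ?thesis
    by (auto simp: simplicial_chains_def)
qed

lemma chain_eq_sum_elementary:
  assumes c: "c \<in> simplicial_chains p K"
  shows "\<exists>B. finite B \<and> (\<forall>xs\<in>B. distinct xs \<and> length xs = Suc p \<and> set xs \<in> K) \<and>
    c = (\<lambda>ys. \<Sum>xs\<in>B. c xs * elementary_chain xs ys)"
proof -
  define r where "r ys = (SOME xs. mset xs = mset ys)" for ys :: "'a list"
  have r: "mset (r ys) = mset ys" for ys
    unfolding r_def by (rule someI) (rule refl)
  have r_cong: "r xs = r ys" if "mset xs = mset ys" for xs ys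
    using that by (simp add: r_def)
  have c_r: "c (r ys) \<noteq> 0 \<longleftrightarrow> c ys \<noteq> 0" for ys
  proof -
    obtain \<pi> where \<pi>: "\<pi> permutes {..<length ys}" "permute_list \<pi> ys = r ys"
      using r by (rule elementary_chain_obtain)
    then show ?thesis
      using simplicial_chains_permute[OF c \<pi>(1)] by (cases \<pi> rule: sign_cases) auto
  qed
  define B where "B = r ` {ys. c ys \<noteq> 0}"
  have "finite B"
    unfolding B_def using simplicial_chains_finite[OF c] by simp
  moreover have B: "distinct xs \<and> length xs = Suc p \<and> set xs \<in> K" if "xs \<in> B" for xs
    using that simplicial_chains_support[OF c] c_r unfolding B_def by blast
  moreover have "c ys = (\<Sum>xs\<in>B. c xs * elementary_chain xs ys)" for ys
  proof -
    have 0: "elementary_chain xs ys = 0" if "xs \<in> B" "xs \<noteq> r ys" for xs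
    proof (rule elementary_chain_outside)
      show "mset ys \<noteq> mset xs"
        using that r r_cong unfolding B_def by (metis imageE)
    qed
    obtain \<pi> where \<pi>: "\<pi> permutes {..<length (r ys)}" "permute_list \<pi> (r ys) = ys"
      using r[symmetric] by (rule elementary_chain_obtain)
    show ?thesis
    proof (cases "c ys = 0")
      case True
      have "c xs * elementary_chain xs ys = 0" if "xs \<in> B" for xs
        using 0[OF that] True c_r by (cases "xs = r ys") auto
      then show ?thesis
        using True by (metis (mono_tags, lifting) sum.neutral)
    next
      case False
      then have "r ys \<in> B"
        by (auto simp: B_def)
      then have "(\<Sum>xs\<in>B. c xs * elementary_chain xs ys) = (\<Sum>xs\<in>{r ys}. c xs * elementary_chain xs ys)"
        using \<open>finite B\<close> 0 by (intro sum.mono_neutral_right) auto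
      also have "\<dots> = c (r ys) * of_int (sign \<pi>)"
        using elementary_chain_permute[OF _ \<pi>(1), where 'b = 'b] B[OF \<open>r ys \<in> B\<close>] \<pi>(2) by simp
      also have "\<dots> = c ys"
        using simplicial_chains_permute[OF c \<pi>(1)] \<pi>(2) by (simp add: mult.commute)
      finally show ?thesis
        by simp
    qed
  qed
  ultimately show ?thesis
    by blast
qed

lemma chain_swap:
  assumes c: "c \<in> simplicial_chains p K"
  shows "c (as @ x # y # bs) = - c (as @ y # x # bs)"
proof -
  let ?\<tau> = "transpose (length as) (Suc (length as))"
  have "permute_list ?\<tau> (as @ y # x # bs) = as @ x # y # bs"
    by (rule nth_equalityI)
      (auto simp: permute_list_def nth_append nth_Cons transpose_def simp del: upt_Suc split: nat.splits)
  then show ?thesis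
    using simplicial_chains_permute[OF c, of ?\<tau> "as @ y # x # bs"]
    by (simp add: permutes_swap_id sign_swap_id)
qed

lemma chain_move:
  assumes c: "c \<in> simplicial_chains p K"
  shows "c (v # as @ bs) = (-1) ^ length as * c (as @ v # bs)"
proof (induction as arbitrary: bs rule: rev_induct)
  case (snoc x as)
  show ?case
    using snoc[of "x # bs"] chain_swap[OF c, of as v x bs] by simp
qed simp

lemma elementary_chain_self: "distinct xs \<Longrightarrow> elementary_chain xs xs = 1"
  using elementary_chain_permute[of xs id] by simp

lemma elementary_chain_Cons:
  assumes "distinct (as @ v # bs)"
  shows "elementary_chain (as @ v # bs) (v # ys) =
    ((-1) ^ length as * elementary_chain (as @ bs) ys :: 'f::field)"
proof (cases "mset ys = mset (as @ bs)")
  case True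
  then obtain \<pi> where \<pi>: "\<pi> permutes {..<length (as @ bs)}" "permute_list \<pi> (as @ bs) = ys"
    by (rule elementary_chain_obtain)
  let ?c = "elementary_chain (as @ v # bs) :: _ \<Rightarrow> 'f"
  have c: "?c \<in> simplicial_chains (length (as @ bs)) {set (as @ v # bs)}"
    using assms by (intro elementary_chain_in_chains) auto
  have "?c (v # ys) = of_int (sign \<pi>) * ?c (v # as @ bs)"
    using chain_Cons_permute[OF c \<pi>(1)] \<pi>(2) by simp
  also have "?c (v # as @ bs) = (-1) ^ length as"
    using chain_move[OF c] elementary_chain_self[OF assms, where 'b = 'f] by simp
  also have "(of_int (sign \<pi>) :: 'f) = elementary_chain (as @ bs) ys"
    using elementary_chain_permute[OF _ \<pi>(1), where 'b = 'f] \<pi>(2) assms by simp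
  finally show ?thesis
    by (simp add: mult.commute)
next
  case False
  then show ?thesis
    by (simp add: elementary_chain_outside)
qed

lemma boundary_elementary_chain:
  assumes xs: "distinct xs" "2 \<le> length xs"
  shows "boundary (elementary_chain xs :: 'a list \<Rightarrow> 'f::field) =
    (\<lambda>ys. \<Sum>i<length xs. (-1) ^ i * elementary_chain (take i xs @ drop (Suc i) xs) ys)"
proof
  fix ys
  let ?c = "elementary_chain xs :: 'a list \<Rightarrow> 'f"
  show "boundary ?c ys = (\<Sum>i<length xs. (-1) ^ i * elementary_chain (take i xs @ drop (Suc i) xs) ys)"
  proof (cases "ys = []")
    case True
    have "elementary_chain (take i xs @ drop (Suc i) xs) ([] :: 'a list) = (0 :: 'f)"
      if "i < length xs" for i
    proof (rule elementary_chain_outside)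
      have "length (take i xs @ drop (Suc i) xs) \<noteq> 0"
        using xs(2) that by simp
      then show "mset [] \<noteq> mset (take i xs @ drop (Suc i) xs)"
        by (metis length_0_conv mset_zero_iff)
    qed
    then show ?thesis
      using True by (simp add: boundary_def)
  next
    case False
    have "v \<in> set xs" if "?c (v # ys) \<noteq> 0" for v
      using that elementary_chain_outside by (metis list.set_intros(1) mset_eq_setD)
    then have "boundary ?c ys = (\<Sum>v\<in>set xs. ?c (v # ys))"
      using False by (intro boundary_eq_sum) auto
    also have "set xs = (!) xs ` {..<length xs}"
      by (auto simp: set_conv_nth)
    also have "(\<Sum>v\<in>(!) xs ` {..<length xs}. ?c (v # ys)) = (\<Sum>i<length xs. ?c (xs ! i # ys))"
      using xs(1) by (subst sum.reindex) (auto simp: inj_on_nth)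
    also have "\<dots> = (\<Sum>i<length xs. (-1) ^ i * elementary_chain (take i xs @ drop (Suc i) xs) ys)"
    proof (rule sum.cong)
      fix i assume "i \<in> {..<length xs}"
      then have i: "i < length xs" "xs = take i xs @ xs ! i # drop (Suc i) xs"
        by (auto simp: id_take_nth_drop)
      then have "?c (xs ! i # ys) = (-1) ^ length (take i xs) * elementary_chain (take i xs @ drop (Suc i) xs) ys"
        using elementary_chain_Cons[of "take i xs" "xs ! i" "drop (Suc i) xs" ys] xs(1) by metis
      then show "?c (xs ! i # ys) = (-1) ^ i * elementary_chain (take i xs @ drop (Suc i) xs) ys"
        using i(1) by simp
    qed simp
    finally show ?thesis .
  qed
qed


section \<open>Rips homology is a persistence module\<close>

context
  fixes K :: "'f ring" and V :: "('f, 'v) module" and W :: "'v set"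
  assumes V: "vectorspace K V" and W: "submodule K W V"
begin

interpretation V: vectorspace K V
  by (rule V)

interpretation W: abelian_subgroup W V
proof (rule abelian_subgroupI3[OF additive_subgroup.intro])
  have "\<ominus>\<^bsub>V\<^esub> v \<in> W" if "v \<in> W" for v
  proof -
    have "\<ominus>\<^bsub>K\<^esub> \<one>\<^bsub>K\<^esub> \<odot>\<^bsub>V\<^esub> v \<in> W"
      using that by (intro submodule.smult_closed[OF W]) auto
    then show ?thesis
      using that submodule.subset[OF W] by (simp add: V.smult_minus_1 subset_iff)
  qed
  then show "subgroup W (add_monoid V)"
    using submodule.subset[OF W] submodule.m_closed[OF W] submodule.zero_closed[OF W]
    by unfold_locales (auto simp: a_inv_def[symmetric])
qed (rule V.abelian_group_axioms)

lemma quotient_carrier: "carrier (quotient_space V W) = {W +>\<^bsub>V\<^esub> v |v. v \<in> carrier V}"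
  by (auto simp: quotient_space_def A_RCOSETS_def')

lemma quotient_classI: "v \<in> carrier V \<Longrightarrow> W +>\<^bsub>V\<^esub> v \<in> carrier (quotient_space V W)"
  unfolding quotient_carrier by blast

lemma quotient_obtain:
  assumes "C \<in> carrier (quotient_space V W)"
  obtains v where "v \<in> carrier V" "C = W +>\<^bsub>V\<^esub> v"
  using assms unfolding quotient_carrier by blast

lemma quotient_zero: "\<zero>\<^bsub>quotient_space V W\<^esub> = W +>\<^bsub>V\<^esub> \<zero>\<^bsub>V\<^esub>"
  using V.a_coset_add_zero[OF W.a_subset] by (simp add: quotient_space_def)

lemma quotient_add:
  "\<lbrakk>v \<in> carrier V; w \<in> carrier V\<rbrakk>
    \<Longrightarrow> (W +>\<^bsub>V\<^esub> v) \<oplus>\<^bsub>quotient_space V W\<^esub> (W +>\<^bsub>V\<^esub> w) = W +>\<^bsub>V\<^esub> (v \<oplus>\<^bsub>V\<^esub> w)"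
  by (simp add: quotient_space_def W.a_rcos_sum)

lemma coset_absorb:
  assumes "w \<in> W" "v \<in> carrier V"
  shows "W +>\<^bsub>V\<^esub> (w \<oplus>\<^bsub>V\<^esub> v) = W +>\<^bsub>V\<^esub> v"
proof -
  have "w \<oplus>\<^bsub>V\<^esub> v \<in> W +>\<^bsub>V\<^esub> v"
    using assms by (auto simp: a_r_coset_def')
  then show ?thesis
    using V.a_repr_independence[OF _ assms(2) W.a_subgroup] by blast
qed

lemma quotient_smult:
  assumes "a \<in> carrier K" "v \<in> carrier V"
  shows "a \<odot>\<^bsub>quotient_space V W\<^esub> (W +>\<^bsub>V\<^esub> v) = W +>\<^bsub>V\<^esub> (a \<odot>\<^bsub>V\<^esub> v)"
proof -
  have "W +>\<^bsub>V\<^esub> (a \<odot>\<^bsub>V\<^esub> u) = W +>\<^bsub>V\<^esub> (a \<odot>\<^bsub>V\<^esub> v)" if u: "u \<in> W +>\<^bsub>V\<^esub> v" for u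
  proof -
    obtain w where w: "w \<in> W" "u = w \<oplus>\<^bsub>V\<^esub> v"
      using u by (auto simp: a_r_coset_def')
    have "w \<in> carrier V"
      using w(1) W.a_subset by blast
    then have "a \<odot>\<^bsub>V\<^esub> u = a \<odot>\<^bsub>V\<^esub> w \<oplus>\<^bsub>V\<^esub> a \<odot>\<^bsub>V\<^esub> v"
      using assms w(2) by (simp add: V.smult_r_distr)
    moreover have "a \<odot>\<^bsub>V\<^esub> w \<in> W"
      using assms(1) w(1) by (rule submodule.smult_closed[OF W])
    ultimately show ?thesis
      using assms by (simp add: coset_absorb)
  qed
  moreover have "v \<in> W +>\<^bsub>V\<^esub> v"
    using assms(2) by (rule W.a_rcos_self)
  ultimately show ?thesis
    unfolding quotient_space_def module.simps by (intro SUP_eq_const) blast+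
qed

lemma vectorspace_quotient: "vectorspace K (quotient_space V W)"
proof (rule vs_criteria)
  show "field K"
    by (rule V.field_axioms)
  show "\<forall>v\<in>carrier (quotient_space V W). \<exists>neg_v\<in>carrier (quotient_space V W).
      v \<oplus>\<^bsub>quotient_space V W\<^esub> neg_v = \<zero>\<^bsub>quotient_space V W\<^esub>"
  proof
    fix C assume "C \<in> carrier (quotient_space V W)"
    then obtain v where v: "v \<in> carrier V" "C = W +>\<^bsub>V\<^esub> v"
      by (auto simp: quotient_carrier)
    have "C \<oplus>\<^bsub>quotient_space V W\<^esub> (W +>\<^bsub>V\<^esub> (\<ominus>\<^bsub>V\<^esub> v)) = \<zero>\<^bsub>quotient_space V W\<^esub>"
      using v by (simp add: quotient_add quotient_zero V.r_neg)
    moreover have "W +>\<^bsub>V\<^esub> (\<ominus>\<^bsub>V\<^esub> v) \<in> carrier (quotient_space V W)"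
      using v(1) by (simp add: quotient_classI)
    ultimately show "\<exists>D\<in>carrier (quotient_space V W). C \<oplus>\<^bsub>quotient_space V W\<^esub> D = \<zero>\<^bsub>quotient_space V W\<^esub>"
      by blast
  qed
  show "\<forall>C D. C \<in> carrier (quotient_space V W) \<and> D \<in> carrier (quotient_space V W) \<longrightarrow>
      C \<oplus>\<^bsub>quotient_space V W\<^esub> D = D \<oplus>\<^bsub>quotient_space V W\<^esub> C"
    by (auto simp: quotient_carrier quotient_add V.a_comm)
  show "\<zero>\<^bsub>quotient_space V W\<^esub> \<in> carrier (quotient_space V W)"
    unfolding quotient_zero by (rule quotient_classI) simp
  show "\<forall>C\<in>carrier (quotient_space V W). C \<oplus>\<^bsub>quotient_space V W\<^esub> \<zero>\<^bsub>quotient_space V W\<^esub> = C"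
    unfolding quotient_zero by (auto elim!: quotient_obtain simp: quotient_add simp del: V.a_coset_add_zero)
qed (auto elim!: quotient_obtain simp: quotient_classI quotient_add quotient_smult
      V.a_assoc V.smult_assoc1 V.smult_l_distr V.smult_r_distr)

end

lemma vectorspace_chain_space: "vectorspace class_ring (chain_space p K)"
proof (rule vs_criteria)
  show "field (class_ring :: 'a ring)"
    by (rule class_field)
  show "\<forall>v\<in>carrier (chain_space p K). \<exists>neg_v\<in>carrier (chain_space p K).
      v \<oplus>\<^bsub>chain_space p K\<^esub> neg_v = \<zero>\<^bsub>chain_space p K\<^esub>"
  proof
    fix v assume "v \<in> carrier (chain_space p K)"
    then show "\<exists>neg_v\<in>carrier (chain_space p K). v \<oplus>\<^bsub>chain_space p K\<^esub> neg_v = \<zero>\<^bsub>chain_space p K\<^esub>"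
      using simplicial_chains_smult[of v p K "-1"]
      by (intro bexI[of _ "\<lambda>xs. (-1) * v xs"]) (auto simp: chain_space_def)
  qed
qed (simp_all add: chain_space_def simplicial_chains_zero simplicial_chains_add
      simplicial_chains_smult add_ac mult.assoc distrib_left distrib_right)

lemma cycle_space_simps:
  "c \<in> carrier (cycle_space p K) \<longleftrightarrow> c \<in> simplicial_chains p K \<and> boundary c = (\<lambda>_. 0)"
  "c \<oplus>\<^bsub>cycle_space p K\<^esub> d = (\<lambda>xs. c xs + d xs)"
  "a \<odot>\<^bsub>cycle_space p K\<^esub> c = (\<lambda>xs. a * c xs)"
  "\<zero>\<^bsub>cycle_space p K\<^esub> = (\<lambda>_. 0)"
  by (auto simp: cycle_space_def chain_space_def)

lemma vectorspace_cycle_space: "vectorspace class_ring (cycle_space p K)"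
proof -
  have "submodule class_ring {c \<in> simplicial_chains p K. boundary c = (\<lambda>_. 0)} (chain_space p K)"
    using vectorspace.axioms(1)[OF vectorspace_chain_space]
    by (rule submodule.intro)
      (auto simp: chain_space_def simplicial_chains_zero simplicial_chains_add
        simplicial_chains_smult boundary_zero boundary_smult boundary_add simplicial_chains_finite)
  then show ?thesis
    unfolding cycle_space_def
    by (intro vectorspace.subspace_is_vs vectorspace_chain_space VectorSpace.subspace.intro)
qed

lemma submodule_boundaries:
  assumes "simplicial_complex K"
  shows "submodule class_ring (boundaries p K) (cycle_space p K)"
proof (rule submodule.intro[OF vectorspace.axioms(1)[OF vectorspace_cycle_space]])
  show "boundaries p K \<subseteq> carrier (cycle_space p K)"
    using assms by (auto simp: boundaries_def cycle_space_simps boundary_in_chains boundary_boundary)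
  show "v \<oplus>\<^bsub>cycle_space p K\<^esub> w \<in> boundaries p K"
    if "v \<in> boundaries p K" "w \<in> boundaries p K" for v w
    using that unfolding boundaries_def cycle_space_simps
    by (auto simp: boundary_add[symmetric] simplicial_chains_finite intro!: imageI simplicial_chains_add)
  show "\<zero>\<^bsub>cycle_space p K\<^esub> \<in> boundaries p K"
    using imageI[OF simplicial_chains_zero, of boundary "Suc p" K]
    by (simp add: boundaries_def cycle_space_simps boundary_zero)
  show "a \<odot>\<^bsub>cycle_space p K\<^esub> v \<in> boundaries p K" if "v \<in> boundaries p K" for a v
  proof -
    from that obtain c where "c \<in> simplicial_chains (Suc p) K" "v = boundary c"
      by (auto simp: boundaries_def)
    then show ?thesis
      using imageI[OF simplicial_chains_smult, of c "Suc p" K boundary a]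
      by (simp add: boundaries_def cycle_space_simps boundary_smult)
  qed
qed

lemma homology_carrier:
  assumes "simplicial_complex K"
  shows "carrier (homology p K) =
    {boundaries p K +>\<^bsub>cycle_space p K\<^esub> c |c. c \<in> carrier (cycle_space p K)}"
  unfolding homology_def
  by (rule quotient_carrier[OF vectorspace_cycle_space submodule_boundaries[OF assms]])

lemma homology_obtain:
  assumes "simplicial_complex K" "C \<in> carrier (homology p K)"
  obtains c where "c \<in> carrier (cycle_space p K)" "C = boundaries p K +>\<^bsub>cycle_space p K\<^esub> c"
  using assms(2) unfolding homology_carrier[OF assms(1)] by blast

lemma homology_classI:
  assumes "simplicial_complex K" "c \<in> carrier (cycle_space p K)"
  shows "boundaries p K +>\<^bsub>cycle_space p K\<^esub> c \<in> carrier (homology p K)"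
  using assms(2) unfolding homology_carrier[OF assms(1)] by blast

lemma vectorspace_homology:
  assumes "simplicial_complex K"
  shows "vectorspace class_ring (homology p K)"
  unfolding homology_def
  by (rule vectorspace_quotient[OF vectorspace_cycle_space submodule_boundaries[OF assms]])

lemma cycle_space_mono: "K \<subseteq> L \<Longrightarrow> carrier (cycle_space p K) \<subseteq> carrier (cycle_space p L)"
  by (intro subsetI) (simp add: cycle_space_simps subsetD[OF simplicial_chains_mono[of K L]])

lemma boundaries_mono: "K \<subseteq> L \<Longrightarrow> boundaries p K \<subseteq> boundaries p L"
  unfolding boundaries_def by (intro image_mono simplicial_chains_mono)

lemma homology_inclusion_class:
  assumes KL: "simplicial_complex K" "simplicial_complex L" "K \<subseteq> L"
    and c: "c \<in> carrier (cycle_space p K)"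
  shows "homology_inclusion p L (boundaries p K +>\<^bsub>cycle_space p K\<^esub> c) =
    boundaries p L +>\<^bsub>cycle_space p L\<^esub> c"
proof -
  have cL: "c \<in> carrier (cycle_space p L)"
    using c cycle_space_mono[OF KL(3)] by blast
  have "boundaries p L +>\<^bsub>cycle_space p L\<^esub> d = boundaries p L +>\<^bsub>cycle_space p L\<^esub> c"
    if d: "d \<in> boundaries p K +>\<^bsub>cycle_space p K\<^esub> c" for d
  proof -
    obtain b where b: "b \<in> boundaries p K" "d = b \<oplus>\<^bsub>cycle_space p L\<^esub> c"
      using d by (auto simp: a_r_coset_def' cycle_space_simps)
    then have "b \<in> boundaries p L"
      using boundaries_mono[OF KL(3)] by blast
    then show ?thesis
      unfolding b(2) by (rule coset_absorb[OF vectorspace_cycle_space submodule_boundaries[OF KL(2)] _ cL])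
  qed
  moreover have "c \<in> boundaries p K +>\<^bsub>cycle_space p K\<^esub> c"
  proof -
    have "\<zero>\<^bsub>cycle_space p K\<^esub> \<in> boundaries p K"
      by (rule submodule.zero_closed[OF submodule_boundaries[OF KL(1)]])
    then show ?thesis
      by (force simp: a_r_coset_def' cycle_space_simps)
  qed
  ultimately show ?thesis
    unfolding homology_inclusion_def by (intro SUP_eq_const) blast+
qed

lemma homology_inclusion_linear:
  assumes KL: "simplicial_complex K" "simplicial_complex L" "K \<subseteq> L"
  shows "linear_map class_ring (homology p K) (homology p L)
    (homology_inclusion p L :: ('x list \<Rightarrow> 'f::field) set \<Rightarrow> _)"
proof -
  note vs = vectorspace_homology[OF KL(1)] vectorspace_homology[OF KL(2)]
  note sK = vectorspace_cycle_space submodule_boundaries[OF KL(1)]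
  note sL = vectorspace_cycle_space submodule_boundaries[OF KL(2)]
  have add: "c \<oplus>\<^bsub>cycle_space p K\<^esub> d \<in> carrier (cycle_space p K)"
    if "c \<in> carrier (cycle_space p K)" "d \<in> carrier (cycle_space p K)" for c d :: "'x list \<Rightarrow> 'f"
    using that by (auto simp: cycle_space_simps simplicial_chains_add boundary_add simplicial_chains_finite)
  have smult: "a \<odot>\<^bsub>cycle_space p K\<^esub> c \<in> carrier (cycle_space p K)"
    if "c \<in> carrier (cycle_space p K)" for a and c :: "'x list \<Rightarrow> 'f"
    using that by (auto simp: cycle_space_simps simplicial_chains_smult boundary_smult)
  have ops: "c \<oplus>\<^bsub>cycle_space p K\<^esub> d = c \<oplus>\<^bsub>cycle_space p L\<^esub> d"
    "a \<odot>\<^bsub>cycle_space p K\<^esub> c = a \<odot>\<^bsub>cycle_space p L\<^esub> c" for a and c d :: "'x list \<Rightarrow> 'f"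
    by (simp_all add: cycle_space_simps)
  have sub: "c \<in> carrier (cycle_space p L)" if "c \<in> carrier (cycle_space p K)" for c :: "'x list \<Rightarrow> 'f"
    using that cycle_space_mono[OF KL(3)] by blast
  note cls = homology_inclusion_class[OF KL]
  have "(homology_inclusion p L :: ('x list \<Rightarrow> 'f) set \<Rightarrow> _) \<in> module_hom class_ring (homology p K) (homology p L)"
    unfolding module_hom_def mem_Collect_eq
  proof (intro conjI allI impI Pi_I)
    fix C :: "('x list \<Rightarrow> 'f) set" assume "C \<in> carrier (homology p K)"
    with KL(1) obtain c where c: "c \<in> carrier (cycle_space p K)"
      "C = boundaries p K +>\<^bsub>cycle_space p K\<^esub> c"
      by (rule homology_obtain)
    show "homology_inclusion p L C \<in> carrier (homology p L)"
      unfolding c(2) cls[OF c(1)] by (rule homology_classI[OF KL(2) sub[OF c(1)]])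
  next
    fix C D :: "('x list \<Rightarrow> 'f) set" assume CD: "C \<in> carrier (homology p K) \<and> D \<in> carrier (homology p K)"
    obtain c where c: "c \<in> carrier (cycle_space p K)"
      "C = boundaries p K +>\<^bsub>cycle_space p K\<^esub> c"
      using KL(1) conjunct1[OF CD] by (rule homology_obtain)
    obtain d where d: "d \<in> carrier (cycle_space p K)"
      "D = boundaries p K +>\<^bsub>cycle_space p K\<^esub> d"
      using KL(1) conjunct2[OF CD] by (rule homology_obtain)
    have "homology_inclusion p L (C \<oplus>\<^bsub>homology p K\<^esub> D) =
        boundaries p L +>\<^bsub>cycle_space p L\<^esub> (c \<oplus>\<^bsub>cycle_space p K\<^esub> d)"
      unfolding c(2) d(2) homology_def quotient_add[OF sK c(1) d(1)] by (rule cls[OF add[OF c(1) d(1)]])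
    also have "\<dots> = homology_inclusion p L C \<oplus>\<^bsub>homology p L\<^esub> homology_inclusion p L D"
      unfolding c(2) d(2) cls[OF c(1)] cls[OF d(1)] homology_def ops
      by (rule quotient_add[OF sL sub[OF c(1)] sub[OF d(1)], symmetric])
    finally show "homology_inclusion p L (C \<oplus>\<^bsub>homology p K\<^esub> D) =
        homology_inclusion p L C \<oplus>\<^bsub>homology p L\<^esub> homology_inclusion p L D" .
  next
    fix a :: 'f and C :: "('x list \<Rightarrow> 'f) set" assume "a \<in> carrier class_ring \<and> C \<in> carrier (homology p K)"
    then have a: "a \<in> carrier class_ring" and C: "C \<in> carrier (homology p K)"
      by blast+
    obtain c where c: "c \<in> carrier (cycle_space p K)"
      "C = boundaries p K +>\<^bsub>cycle_space p K\<^esub> c"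
      using KL(1) C by (rule homology_obtain)
    have "homology_inclusion p L (a \<odot>\<^bsub>homology p K\<^esub> C) =
        boundaries p L +>\<^bsub>cycle_space p L\<^esub> (a \<odot>\<^bsub>cycle_space p K\<^esub> c)"
      unfolding c(2) homology_def quotient_smult[OF sK a c(1)] by (rule cls[OF smult[OF c(1)]])
    also have "\<dots> = a \<odot>\<^bsub>homology p L\<^esub> homology_inclusion p L C"
      unfolding c(2) cls[OF c(1)] homology_def ops
      by (rule quotient_smult[OF sL a sub[OF c(1)], symmetric])
    finally show "homology_inclusion p L (a \<odot>\<^bsub>homology p K\<^esub> C) =
        a \<odot>\<^bsub>homology p L\<^esub> homology_inclusion p L C" .
  qed
  then show ?thesis
    by (rule linear_map.intro[OF vs mod_hom.intro[OF vs[THEN vectorspace.axioms(1)] mod_hom_axioms.intro]])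
qed

lemma simplicial_complex_rips: "simplicial_complex (rips X h t)"
  unfolding simplicial_complex_def rips_def by (auto dest: finite_subset)

lemma rips_mono: "t \<le> s \<Longrightarrow> rips X h t \<subseteq> rips X h s"
  unfolding rips_def by (auto intro: order_trans)

lemma persistence_module_rips_homology: "persistence_module (rips_homology k X h)"
  (is "persistence_module ?P")
proof (rule persistence_module.intro)
  show "linear_map class_ring (pspace ?P t) (pspace ?P s)
      (pmap ?P t s)" if "t \<le> s" for t s
    using homology_inclusion_linear[OF simplicial_complex_rips simplicial_complex_rips rips_mono[OF that]]
    by (simp add: rips_homology_def)
next
  fix v t assume "v \<in> carrier (pspace ?P t)"
  then obtain c where c: "c \<in> carrier (cycle_space k (rips X h t))"
    "v = boundaries k (rips X h t) +>\<^bsub>cycle_space k (rips X h t)\<^esub> c"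
    by (auto simp: rips_homology_def elim: homology_obtain[OF simplicial_complex_rips])
  show "pmap ?P t t v = v"
    unfolding c(2) using c(1) by (simp add: rips_homology_def homology_inclusion_class simplicial_complex_rips)
next
  fix t s r :: real and v
  assume ts: "t \<le> s" "s \<le> r" and "v \<in> carrier (pspace ?P t)"
  then obtain c where c: "c \<in> carrier (cycle_space k (rips X h t))"
    "v = boundaries k (rips X h t) +>\<^bsub>cycle_space k (rips X h t)\<^esub> c"
    by (auto simp: rips_homology_def elim: homology_obtain[OF simplicial_complex_rips])
  have "c \<in> carrier (cycle_space k (rips X h s))"
    using c(1) cycle_space_mono[OF rips_mono[OF ts(1)]] by blast
  then show "pmap ?P t r v =
      pmap ?P s r (pmap ?P t s v)"
    using c ts by (simp add: rips_homology_def homology_inclusion_class simplicial_complex_rips rips_mono)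
qed

end

theory Submission
  imports Defs
begin

text \<open>
  A correspondence of distortion below \<open>\<epsilon>\<close> contains the graphs of vertex maps
  \<open>\<phi>: X \<rightarrow> Y\<close> and \<open>\<psi>: Y \<rightarrow> X\<close>. These are simplicial from the Rips complexes at
  scale \<open>t\<close> to those at scale \<open>t + \<epsilon>\<close>, and both composites are contiguous to the inclusions
  into scale \<open>t + 2\<epsilon>\<close>, so they induce an \<open>\<epsilon>\<close>-interleaving in homology.

  The usual prism operator depends on an ordering of the vertices and does not act on oriented
  chains. Contiguity is therefore treated one vertex at a time, using only cones.
\<close>

section \<open>Alternating functions on lists\<close>

text \<open>Chains live on all orderings of a simplex at once, so no ordering of the vertices has to
  be chosen or respected by the maps. Moving vertices one by one would not end for an infinite
  vertex set, but a single cycle involves only finitely many vertices, so a finite telescoping sum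
  suffices for each homology class. Every intermediate image of a simplex \<sigma> lies inside the
  union of \<sigma> with its final image. At each step the simplices needed are therefore faces of
  that one union, and the metric estimate only has to show that the union is a simplex at scale
  \<open>t + 2 * \<epsilon>\<close>.\<close>

text \<open>Only adjacent entries are mentioned, so that induction on the prefix \<open>as\<close>
  can reach them. The second clause is separate because in characteristic 2 the first one says
  nothing about repeated entries.\<close>

definition alternating :: "('x list \<Rightarrow> 'f::field) \<Rightarrow> bool" where
  "alternating c \<longleftrightarrow>
     (\<forall>as x y bs. c (as @ x # y # bs) = - c (as @ y # x # bs)) \<and>
     (\<forall>as x bs. c (as @ x # x # bs) = 0)"

lemma alternatingD:
  assumes "alternating c"
  shows "c (as @ x # y # bs) = - c (as @ y # x # bs)" "c (as @ x # x # bs) = 0"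
  using assms unfolding alternating_def by blast+

lemma alternating_swap_Cons: "alternating c \<Longrightarrow> c (x # y # bs) = - c (y # x # bs)"
  using alternatingD(1)[of c "[]" x y bs] by simp

lemma alternating_Cons:
  assumes "alternating c"
  shows "alternating (\<lambda>xs. c (x # xs))"
  unfolding alternating_def
proof (intro conjI allI)
  show "c (x # as @ y # z # bs) = - c (x # as @ z # y # bs)" for as y z bs
    using alternatingD(1)[OF assms, of "x # as" y z bs] by simp
  show "c (x # as @ y # y # bs) = 0" for as y bs
    using alternatingD(2)[OF assms, of "x # as" y bs] by simp
qed

text \<open>Exchanging \<open>x\<close> and \<open>y\<close> across \<open>m # ms\<close> takes
  three sign changes: \<open>x\<close> past \<open>m\<close>, the exchange across \<open>ms\<close>,
  then \<open>m\<close> past \<open>y\<close>.\<close>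

lemma alternating_transpose:
  assumes "alternating c"
  shows "c (as @ x # ms @ y # bs) = - c (as @ y # ms @ x # bs)"
proof (induction ms arbitrary: as)
  case Nil
  show ?case
    using alternatingD(1)[OF assms, of as x y bs] by simp
next
  case (Cons m ms)
  show ?case
    using alternatingD(1)[OF assms, of as x m "ms @ y # bs"] Cons[of "as @ [m]"]
      alternatingD(1)[OF assms, of as m y "ms @ x # bs"] by simp
qed

text \<open>Adjacent swaps bring two equal entries side by side, changing the value by at most a
  sign, and there it is 0.\<close>

lemma alternating_distinct:
  assumes "alternating c" "c xs \<noteq> 0"
  shows "distinct xs"
proof (rule ccontr)
  have *: "c (as @ y # bs @ y # cs) = 0" for as bs cs y
  proof (induction bs arbitrary: as)
    case Nil
    show ?case
      using alternatingD(2)[OF assms(1), of as y cs] by simp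
  next
    case (Cons b bs)
    show ?case
      using alternatingD(1)[OF assms(1), of as y b "bs @ y # cs"] Cons[of "as @ [b]"] by simp
  qed
  assume "\<not> distinct xs"
  then obtain as bs cs y where "xs = as @ [y] @ bs @ [y] @ cs"
    using not_distinct_decomp by blast
  then show False
    using * assms(2) by simp
qed

lemma alternating_permute_transpose:
  assumes "alternating c" "i < j" "j < length xs"
  shows "c (permute_list (transpose i j) xs) = - c xs"
proof -
  define as ms bs where "as = take i xs" and "ms = take (j - Suc i) (drop (Suc i) xs)"
    and "bs = drop (Suc j) xs"
  have len: "length as = i" "length ms = j - Suc i"
    using assms by (auto simp: as_def ms_def)
  have xs: "xs = as @ xs ! i # ms @ xs ! j # bs"
  proof -
    have "drop (Suc i) xs = ms @ drop (j - Suc i) (drop (Suc i) xs)"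
      unfolding ms_def by (rule append_take_drop_id[symmetric])
    also have "drop (j - Suc i) (drop (Suc i) xs) = xs ! j # bs"
      using assms by (simp add: bs_def Cons_nth_drop_Suc)
    finally show ?thesis
      using assms id_take_nth_drop[of i xs] by (simp add: as_def)
  qed
  have "permute_list (transpose i j) xs = as @ xs ! j # ms @ xs ! i # bs"
  proof (rule nth_equalityI)
    show "length (permute_list (transpose i j) xs) = length (as @ xs ! j # ms @ xs ! i # bs)"
      using assms by (simp add: len bs_def)
  next
    fix k assume "k < length (permute_list (transpose i j) xs)"
    then have k: "k < length xs"
      by simp
    have perm: "permute_list (transpose i j) xs ! k = xs ! transpose i j k"
      using k by (simp add: permute_list_def)
    consider "k = i" | "k = j" | "k \<noteq> i" "k \<noteq> j"
      by blast
    then show "permute_list (transpose i j) xs ! k = (as @ xs ! j # ms @ xs ! i # bs) ! k"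
    proof cases
      case 3
      have "xs ! k = (as @ xs ! i # ms @ xs ! j # bs) ! k"
        by (rule arg_cong[OF xs])
      also have "\<dots> = (as @ xs ! j # ms @ xs ! i # bs) ! k"
        using 3 assms(2) len by (auto simp: nth_append nth_Cons split: nat.splits)
      finally show ?thesis
        using 3 perm by (simp add: transpose_def)
    qed (use perm assms(2) len in \<open>auto simp: nth_append nth_Cons split: nat.splits\<close>)
  qed
  then show ?thesis
    using alternating_transpose[OF assms(1), of as "xs ! j" ms "xs ! i" bs] xs[symmetric] by simp
qed

text \<open>Transpositions generate all permutations. The induction splits them off on the right, so
  each acts as the last rearrangement of the already permuted list.\<close>

lemma alternating_permute:
  assumes c: "alternating c" and \<pi>: "\<pi> permutes {..<length xs}"
  shows "c (permute_list \<pi> xs) = of_int (sign \<pi>) * c xs"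
proof -
  have "\<forall>ys. length ys = length xs \<longrightarrow> c (permute_list \<pi> ys) = of_int (sign \<pi>) * c ys"
    using finite_lessThan \<pi>
  proof (induction rule: permutes_rev_induct)
    case id
    then show ?case
      by simp
  next
    case (swap i j p)
    show ?case
    proof (intro allI impI)
      fix ys :: "'a list" assume len: "length ys = length xs"
      let ?t = "transpose i j"
      have t: "?t permutes {..<length ys}"
        using swap len by (simp add: permutes_swap_id)
      have swp: "c (permute_list ?t zs) = of_int (sign ?t) * c zs" if "length zs = length xs" for zs
      proof -
        consider "i = j" | "i < j" | "j < i"
          by linarith
        then show ?thesis
        proof cases
          case 1
          then show ?thesis
            by simp
        next
          case 2
          then show ?thesis
            using alternating_permute_transpose[OF c 2, of zs] swap that by (simp add: sign_swap_id)
        next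
          case 3
          then show ?thesis
            using alternating_permute_transpose[OF c 3, of zs] swap that
            by (simp add: sign_swap_id transpose_commute)
        qed
      qed
      have "permute_list (p \<circ> ?t) ys = permute_list ?t (permute_list p ys)"
        using t by (rule permute_list_compose)
      moreover have "sign (p \<circ> ?t) = sign p * sign ?t"
        using swap(4) by (intro sign_compose)
          (auto intro: permutes_imp_permutation[of "{..<length xs}"] permutation_swap_id)
      ultimately show "c (permute_list (p \<circ> ?t) ys) = of_int (sign (p \<circ> ?t)) * c ys"
        using swp[of "permute_list p ys"] swap(5) len by simp
    qed
  qed
  then show ?thesis
    by blast
qed

text \<open>Reduces membership in the chain space to conditions on neighbouring entries; this is how
  pushforwards and cones are recognised as chains.\<close>

lemma simplicial_chains_iff_alternating:
  "c \<in> simplicial_chains p K \<longleftrightarrow>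
     finite {xs. c xs \<noteq> 0} \<and> (\<forall>xs. c xs \<noteq> 0 \<longrightarrow> length xs = Suc p \<and> set xs \<in> K) \<and> alternating c"
proof
  assume c: "c \<in> simplicial_chains p K"
  have "c (as @ x # x # bs) = 0" for as x bs
    using simplicial_chains_support(2)[OF c, of "as @ x # x # bs"] by auto
  then have "alternating c"
    unfolding alternating_def using chain_swap[OF c] by blast
  then show "finite {xs. c xs \<noteq> 0} \<and> (\<forall>xs. c xs \<noteq> 0 \<longrightarrow> length xs = Suc p \<and> set xs \<in> K) \<and> alternating c"
    using simplicial_chains_finite[OF c] simplicial_chains_support[OF c] by blast
next
  assume "finite {xs. c xs \<noteq> 0} \<and> (\<forall>xs. c xs \<noteq> 0 \<longrightarrow> length xs = Suc p \<and> set xs \<in> K) \<and> alternating c"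
  then show "c \<in> simplicial_chains p K"
    unfolding simplicial_chains_def using alternating_distinct[of c] alternating_permute[of c] by auto
qed

lemma finite_support_Cons:
  assumes "finite {xs. c xs \<noteq> 0}"
  shows "finite {xs. c (x # xs) \<noteq> 0}"
  using finite_vimageI[OF assms, of "Cons x"] by (simp add: vimage_def)

lemma finite_support_obtain_vertices:
  fixes c :: "'x list \<Rightarrow> 'f::field"
  assumes "finite {xs. c xs \<noteq> 0}"
  obtains V where "finite V" "\<And>xs x. c xs \<noteq> 0 \<Longrightarrow> x \<in> set xs \<Longrightarrow> x \<in> V"
  using that[of "\<Union>(set ` {xs. c xs \<noteq> 0})"] assms by auto

lemma finite_support_obtain_heads:
  fixes c :: "'x list \<Rightarrow> 'f::field"
  assumes "finite {xs. c xs \<noteq> 0}"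
  obtains V where "finite V" "\<And>x xs. c (x # xs) \<noteq> 0 \<Longrightarrow> x \<in> V"
  using finite_support_obtain_vertices[OF assms] by (metis list.set_intros(1))


section \<open>Pushforward along a vertex map\<close>

text \<open>Collapsed simplices are not discarded by a case distinction: for alternating
  \<open>c\<close> the values at lists with repeated entries cancel by themselves, see
  \<open>alternating_pushforward\<close>.\<close>

definition pushforward :: "('x \<Rightarrow> 'y) \<Rightarrow> ('x list \<Rightarrow> 'f::field) \<Rightarrow> 'y list \<Rightarrow> 'f" where
  "pushforward f c ys = (\<Sum>xs | c xs \<noteq> 0 \<and> map f xs = ys. c xs)"

text \<open>Frees the index set from the support of \<open>c\<close>, so that sums belonging to
  different chains can be combined or interchanged.\<close>

lemma pushforward_eq_sum:
  assumes "finite A" "\<And>xs. c xs \<noteq> 0 \<Longrightarrow> xs \<in> A"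
  shows "pushforward f c ys = (\<Sum>xs\<in>A. if map f xs = ys then c xs else 0)"
proof -
  have "(\<Sum>xs\<in>A. if map f xs = ys then c xs else 0) = (\<Sum>xs\<in>{xs\<in>A. map f xs = ys}. c xs)"
    using assms(1) by (simp add: sum.inter_filter)
  also have "\<dots> = pushforward f c ys"
    unfolding pushforward_def using assms by (intro sum.mono_neutral_right) auto
  finally show ?thesis
    by simp
qed

lemma pushforward_cong:
  assumes "\<And>xs. map f xs = ys \<Longrightarrow> c xs = d xs"
  shows "pushforward f c ys = pushforward f d ys"
  unfolding pushforward_def using assms by (intro sum.cong) auto

lemma pushforward_cong_map:
  assumes "\<And>xs x. c xs \<noteq> 0 \<Longrightarrow> x \<in> set xs \<Longrightarrow> f x = g x"
  shows "pushforward f c = pushforward g c"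
proof
  have "map f xs = map g xs" if "c xs \<noteq> 0" for xs
    using assms[OF that] by simp
  then show "pushforward f c ys = pushforward g c ys" for ys
    unfolding pushforward_def by (intro sum.cong) auto
qed

lemma pushforward_nonzero:
  assumes "pushforward f c ys \<noteq> 0"
  obtains xs where "c xs \<noteq> 0" "ys = map f xs"
  using sum.not_neutral_contains_not_neutral[OF assms[unfolded pushforward_def]] by blast

lemma finite_support_pushforward:
  assumes "finite {xs. c xs \<noteq> 0}"
  shows "finite {ys. pushforward f c ys \<noteq> 0}"
  by (rule finite_surj[OF assms, of _ "map f"]) (auto elim: pushforward_nonzero)

lemma pushforward_Nil: "pushforward f c [] = c []"
proof -
  have "{xs. c xs \<noteq> 0 \<and> map f xs = []} = (if c [] = 0 then {} else {[]})"
    by auto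
  then show ?thesis
    by (simp add: pushforward_def)
qed

lemma pushforward_zero: "pushforward f (\<lambda>_. 0) = (\<lambda>_. 0)"
  by (rule ext) (simp add: pushforward_def)

lemma pushforward_sum:
  assumes "finite S" "\<And>x. x \<in> S \<Longrightarrow> finite {xs. c x xs \<noteq> 0}"
  shows "pushforward f (\<lambda>xs. \<Sum>x\<in>S. c x xs) ys = (\<Sum>x\<in>S. pushforward f (c x) ys)"
proof -
  let ?A = "\<Union>x\<in>S. {xs. c x xs \<noteq> 0}"
  have A: "finite ?A"
    using assms by blast
  have "pushforward f (\<lambda>xs. \<Sum>x\<in>S. c x xs) ys =
      (\<Sum>xs\<in>?A. if map f xs = ys then \<Sum>x\<in>S. c x xs else 0)"
    using A by (intro pushforward_eq_sum) (auto dest: sum.not_neutral_contains_not_neutral)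
  also have "\<dots> = (\<Sum>xs\<in>?A. \<Sum>x\<in>S. if map f xs = ys then c x xs else 0)"
    by (intro sum.cong) auto
  also have "\<dots> = (\<Sum>x\<in>S. \<Sum>xs\<in>?A. if map f xs = ys then c x xs else 0)"
    by (rule sum.swap)
  also have "\<dots> = (\<Sum>x\<in>S. pushforward f (c x) ys)"
    using A by (intro sum.cong pushforward_eq_sum[symmetric]) auto
  finally show ?thesis .
qed

lemma pushforward_add:
  assumes "finite {xs. c xs \<noteq> 0}" "finite {xs. d xs \<noteq> 0}"
  shows "pushforward f (\<lambda>xs. c xs + d xs) ys = pushforward f c ys + pushforward f d ys"
  using pushforward_sum[of UNIV "\<lambda>b. if b then c else d" f ys] assms by (simp add: UNIV_bool add.commute)

lemma pushforward_smult: "pushforward f (\<lambda>xs. a * c xs) ys = a * pushforward f c ys"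
  by (cases "a = 0") (simp_all add: pushforward_def sum_distrib_left)

lemma pushforward_uminus: "pushforward f (\<lambda>xs. - c xs) ys = - pushforward f c ys"
  using pushforward_smult[of f "-1" c ys] by simp

lemma pushforward_diff:
  assumes "finite {xs. c xs \<noteq> 0}" "finite {xs. d xs \<noteq> 0}"
  shows "pushforward f (\<lambda>xs. c xs - d xs) ys = pushforward f c ys - pushforward f d ys"
  using pushforward_add[of c "\<lambda>xs. - d xs" f ys] assms by (simp add: pushforward_uminus)

lemma pushforward_id: "pushforward (\<lambda>x. x) c = c"
proof
  fix ys
  have "{xs. c xs \<noteq> 0 \<and> xs = ys} = (if c ys = 0 then {} else {ys})"
    by auto
  then show "pushforward (\<lambda>x. x) c ys = c ys"
    by (simp add: pushforward_def)
qed

lemma pushforward_comp: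
  assumes c: "finite {xs. c xs \<noteq> 0}"
  shows "pushforward g (pushforward f c) = pushforward (\<lambda>x. g (f x)) c"
proof
  fix zs
  let ?A = "{xs. c xs \<noteq> 0}"
  have "pushforward g (pushforward f c) zs =
      (\<Sum>ys\<in>map f ` ?A. if map g ys = zs then pushforward f c ys else 0)"
    using c by (intro pushforward_eq_sum) (auto elim!: pushforward_nonzero)
  also have "\<dots> = (\<Sum>ys\<in>map f ` ?A. \<Sum>xs\<in>?A. if map f xs = ys then if map g (map f xs) = zs then c xs else 0 else 0)"
    using c by (intro sum.cong refl) (auto simp: pushforward_eq_sum[of ?A c] intro!: sum.cong)
  also have "\<dots> = (\<Sum>xs\<in>?A. \<Sum>ys\<in>map f ` ?A. if map f xs = ys then if map g (map f xs) = zs then c xs else 0 else 0)"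
    by (rule sum.swap)
  also have "\<dots> = (\<Sum>xs\<in>?A. if map g (map f xs) = zs then c xs else 0)"
    using c by (intro sum.cong refl) (simp add: sum.delta')
  also have "\<dots> = pushforward (\<lambda>x. g (f x)) c zs"
    using c by (subst pushforward_eq_sum[of ?A]) (simp_all add: comp_def)
  finally show "pushforward g (pushforward f c) zs = pushforward (\<lambda>x. g (f x)) c zs" .
qed

text \<open>Slicing by the first vertex: the lists over \<open>y # ys\<close> begin with some
  \<open>x\<close> in the fibre of \<open>y\<close>. This recursion drives the inductions for
  pushforwards and their compatibility with cones.\<close>

lemma pushforward_Cons:
  assumes c: "finite {xs. c xs \<noteq> 0}" and V: "finite V" "\<And>x xs. c (x # xs) \<noteq> 0 \<Longrightarrow> x \<in> V"
  shows "pushforward f c (y # ys) = (\<Sum>x\<in>{x\<in>V. f x = y}. pushforward f (\<lambda>xs. c (x # xs)) ys)"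
proof -
  let ?B = "tl ` {xs. c xs \<noteq> 0}"
  have B: "finite ?B" "\<And>x xs. c (x # xs) \<noteq> 0 \<Longrightarrow> xs \<in> ?B"
    using c by force+
  \<comment> \<open>The support may contain the empty list, which has no head; it maps to
    \<open>[]\<close> and adds nothing at \<open>y # ys\<close>.\<close>
  let ?A = "insert [] ((\<lambda>(x, xs). x # xs) ` (V \<times> ?B))"
  have "pushforward f c (y # ys) = (\<Sum>xs\<in>?A. if map f xs = y # ys then c xs else 0)"
  proof (rule pushforward_eq_sum)
    show "finite ?A"
      using B V by simp
    show "xs \<in> ?A" if "c xs \<noteq> 0" for xs
      using that V(2) B(2) by (cases xs) auto
  qed
  also have "\<dots> = (\<Sum>xs\<in>(\<lambda>(x, xs). x # xs) ` (V \<times> ?B). if map f xs = y # ys then c xs else 0)"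
    using B V by (subst sum.insert) auto
  also have "\<dots> = (\<Sum>(x, xs)\<in>V \<times> ?B. if f x = y \<and> map f xs = ys then c (x # xs) else 0)"
    by (subst sum.reindex) (auto simp: inj_on_def case_prod_unfold intro!: sum.cong)
  also have "\<dots> = (\<Sum>x\<in>V. \<Sum>xs\<in>?B. if f x = y \<and> map f xs = ys then c (x # xs) else 0)"
    by (rule sum.cartesian_product[symmetric])
  also have "\<dots> = (\<Sum>x\<in>V. if f x = y then pushforward f (\<lambda>xs. c (x # xs)) ys else 0)"
    using B by (intro sum.cong refl) (auto simp: pushforward_eq_sum[of ?B] intro!: sum.cong)
  also have "\<dots> = (\<Sum>x\<in>{x\<in>V. f x = y}. pushforward f (\<lambda>xs. c (x # xs)) ys)"
    using V by (simp add: sum.inter_filter)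
  finally show ?thesis .
qed

text \<open>Slicing off \<open>as\<close> leaves a swap of the two leading entries, where the value
  is a double sum over two fibres of a function antisymmetric in the two preimages.\<close>

lemma alternating_pushforward:
  assumes "finite {xs. c xs \<noteq> 0}" "alternating c"
  shows "alternating (pushforward f c)"
proof -
  have *: "pushforward f c (as @ y # z # bs) = - pushforward f c (as @ z # y # bs) \<and>
      pushforward f c (as @ y # y # bs) = 0" for as y z bs
    using assms
  proof (induction as arbitrary: c)
    case (Cons a as)
    obtain V where V: "finite V" "\<And>x xs. c (x # xs) \<noteq> 0 \<Longrightarrow> x \<in> V"
      using finite_support_obtain_heads[OF Cons.prems(1)] by metis
    have IH: "pushforward f (\<lambda>xs. c (x # xs)) (as @ y # z # bs) = - pushforward f (\<lambda>xs. c (x # xs)) (as @ z # y # bs)"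
      "pushforward f (\<lambda>xs. c (x # xs)) (as @ y # y # bs) = 0" for x
      using Cons.IH[OF finite_support_Cons[OF Cons.prems(1)] alternating_Cons[OF Cons.prems(2)]] by blast+
    have "pushforward f c (a # zs) = (\<Sum>x\<in>{x\<in>V. f x = a}. pushforward f (\<lambda>xs. c (x # xs)) zs)" for zs
      by (rule pushforward_Cons[OF Cons.prems(1) V])
    then show ?case
      using IH by (simp add: sum_negf)
  next
    case Nil
    obtain V where V: "finite V" "\<And>xs x. c xs \<noteq> 0 \<Longrightarrow> x \<in> set xs \<Longrightarrow> x \<in> V"
      using finite_support_obtain_vertices[OF Nil(1)] by metis
    have V1: "x \<in> V" if "c (x # xs) \<noteq> 0" for x xs
      using V(2)[OF that] by simp
    have V2: "x' \<in> V" if "c (x # x' # xs) \<noteq> 0" for x x' xs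
      using V(2)[OF that] by simp
    let ?d = "\<lambda>u v. pushforward f (\<lambda>xs. c (u # v # xs)) bs"
    have two: "pushforward f c (u # v # bs) =
        (\<Sum>x\<in>{x\<in>V. f x = u}. \<Sum>x'\<in>{x\<in>V. f x = v}. ?d x x')" for u v
    proof -
      have "pushforward f c (u # v # bs) = (\<Sum>x\<in>{x\<in>V. f x = u}. pushforward f (\<lambda>xs. c (x # xs)) (v # bs))"
        by (rule pushforward_Cons[OF Nil(1) V(1) V1])
      also have "\<dots> = (\<Sum>x\<in>{x\<in>V. f x = u}. \<Sum>x'\<in>{x\<in>V. f x = v}. ?d x x')"
        by (intro sum.cong refl pushforward_Cons[OF finite_support_Cons[OF Nil(1)] V(1) V2])
      finally show ?thesis .
    qed
    have "(\<lambda>xs. c (u # v # xs)) = (\<lambda>xs. - c (v # u # xs))" for u v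
      using alternating_swap_Cons[OF Nil(2)] by blast
    then have swap: "?d u v = - ?d v u" for u v
      using pushforward_uminus[of f "\<lambda>xs. c (v # u # xs)" bs] by metis
    have "(\<lambda>xs. c (u # u # xs)) = (\<lambda>_. 0)" for u
      using alternatingD(2)[OF Nil(2), of "[]"] by auto
    then have diag: "?d u u = 0" for u
      by (simp add: pushforward_zero)
    have "pushforward f c (y # z # bs) = (\<Sum>x\<in>{x\<in>V. f x = y}. \<Sum>x'\<in>{x\<in>V. f x = z}. - ?d x' x)"
      unfolding two using swap by (intro sum.cong refl) blast
    also have "\<dots> = - pushforward f c (z # y # bs)"
      unfolding two by (subst sum.swap) (simp add: sum_negf)
    finally have "pushforward f c (y # z # bs) = - pushforward f c (z # y # bs)" .
    \<comment> \<open>Both preimages now run through the same fibre: off-diagonal terms cancel in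
      pairs and the diagonal is zero, in every characteristic.\<close>
    moreover have "pushforward f c (y # y # bs) = 0"
      unfolding two by (rule sum_antisymmetric[where d = ?d, OF _ diag swap]) (simp add: V(1))
    ultimately show ?case
      by simp
  qed
  then show ?thesis
    unfolding alternating_def by blast
qed

lemma pushforward_in_chains:
  assumes c: "c \<in> simplicial_chains p K" and f: "\<forall>\<sigma>\<in>K. f ` \<sigma> \<in> L"
  shows "pushforward f c \<in> simplicial_chains p L"
proof -
  have "length ys = Suc p \<and> set ys \<in> L" if nz: "pushforward f c ys \<noteq> 0" for ys
  proof -
    obtain xs where "c xs \<noteq> 0" "ys = map f xs"
      using nz by (rule pushforward_nonzero)
    then show ?thesis
      using simplicial_chains_support[OF c, of xs] f by simp
  qed
  then show ?thesis
    using c finite_support_pushforward alternating_pushforward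
    unfolding simplicial_chains_iff_alternating by blast
qed

section \<open>The augmented boundary and naturality of the boundary\<close>

text \<open>At the empty list this keeps the augmentation (sum of coefficients) of a 0-chain, which
  \<open>boundary\<close> sets to 0. Without it the cone formula
  \<open>augmented_boundary_cone\<close> would fail for 0-chains.\<close>

definition augmented_boundary :: "('x list \<Rightarrow> 'f::field) \<Rightarrow> 'x list \<Rightarrow> 'f" where
  "augmented_boundary c ys = (\<Sum>v | c (v # ys) \<noteq> 0. c (v # ys))"

lemma boundary_augmented: "boundary c ys = (if ys = [] then 0 else augmented_boundary c ys)"
  by (simp add: boundary_def augmented_boundary_def)

lemma augmented_boundary_eq_sum:
  assumes "finite V" "\<And>v. c (v # ys) \<noteq> 0 \<Longrightarrow> v \<in> V"
  shows "augmented_boundary c ys = (\<Sum>v\<in>V. c (v # ys))"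
  unfolding augmented_boundary_def using assms by (intro sum.mono_neutral_left) auto

text \<open>Summing over the heads \<open>w\<close> in the image and then over the fibre of each
  \<open>w\<close> is the same as summing over all heads of \<open>c\<close>.\<close>

lemma augmented_boundary_pushforward:
  assumes c: "finite {xs. c xs \<noteq> 0}"
  shows "augmented_boundary (pushforward f c) = pushforward f (augmented_boundary c)"
proof
  fix ys
  obtain V where V: "finite V" "\<And>x xs. c (x # xs) \<noteq> 0 \<Longrightarrow> x \<in> V"
    using finite_support_obtain_heads[OF c] by metis
  have "augmented_boundary (pushforward f c) ys = (\<Sum>w\<in>f ` V. pushforward f c (w # ys))"
  proof (rule augmented_boundary_eq_sum)
    fix w assume "pushforward f c (w # ys) \<noteq> 0"
    then obtain xs where "c xs \<noteq> 0" "w # ys = map f xs"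
      by (rule pushforward_nonzero)
    then show "w \<in> f ` V"
      using V(2) by auto
  qed (use V in simp)
  also have "\<dots> = (\<Sum>w\<in>f ` V. \<Sum>x\<in>{x\<in>V. f x = w}. pushforward f (\<lambda>xs. c (x # xs)) ys)"
    by (intro sum.cong refl pushforward_Cons[OF c V])
  also have "\<dots> = (\<Sum>x\<in>V. pushforward f (\<lambda>xs. c (x # xs)) ys)"
    using V(1) by (rule sum.image_gen[symmetric])
  also have "\<dots> = pushforward f (\<lambda>xs. \<Sum>x\<in>V. c (x # xs)) ys"
    using V(1) c by (intro pushforward_sum[symmetric] finite_support_Cons)
  also have "(\<lambda>xs. \<Sum>x\<in>V. c (x # xs)) = augmented_boundary c"
    using V by (intro ext augmented_boundary_eq_sum[symmetric])
  finally show "augmented_boundary (pushforward f c) ys = pushforward f (augmented_boundary c) ys" .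
qed

lemma boundary_pushforward:
  assumes "finite {xs. c xs \<noteq> 0}"
  shows "boundary (pushforward f c) = pushforward f (boundary c)"
proof
  show "boundary (pushforward f c) ys = pushforward f (boundary c) ys" for ys
  proof (cases "ys = []")
    case False
    \<comment> \<open>Lists that map to a nonempty \<open>ys\<close> are nonempty, and there the two
      boundaries agree.\<close>
    then have "pushforward f (augmented_boundary c) ys = pushforward f (boundary c) ys"
      by (intro pushforward_cong) (auto simp: boundary_augmented)
    then show ?thesis
      using False by (simp add: boundary_augmented augmented_boundary_pushforward[OF assms])
  qed (simp add: pushforward_Nil boundary_def)
qed


section \<open>Cones and contiguous vertex maps\<close>

text \<open>
  The wedge product with the vertex \<open>b\<close>. The recursion takes care of simplices that contain
  \<open>b\<close> already: there the contributions of the two occurrences of \<open>b\<close> cancel.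
\<close>

primrec cone :: "'x \<Rightarrow> ('x list \<Rightarrow> 'f::field) \<Rightarrow> 'x list \<Rightarrow> 'f" where
  "cone b d [] = 0"
| "cone b d (x # xs) = (if x = b then d xs else 0) - cone b (\<lambda>ys. d (x # ys)) xs"

lemma cone_zero: "cone b (\<lambda>_. 0) zs = 0"
  by (induction zs) auto

lemma cone_uminus: "cone b (\<lambda>ys. - d ys) zs = - cone b d zs"
  by (induction zs arbitrary: d) auto

lemma cone_add: "cone b (\<lambda>ys. c ys + d ys) zs = cone b c zs + cone b d zs"
  by (induction zs arbitrary: c d) auto

lemma cone_sum: "cone b (\<lambda>ys. \<Sum>x\<in>S. c x ys) zs = (\<Sum>x\<in>S. cone b (c x) zs)"
  by (induction S rule: infinite_finite_induct) (simp_all add: cone_zero cone_add)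

lemma cone_nonzero:
  assumes "cone b d zs \<noteq> 0"
  shows "\<exists>as bs. zs = as @ b # bs \<and> d (as @ bs) \<noteq> 0"
  using assms
proof (induction zs arbitrary: d)
  case (Cons z zs)
  show ?case
  proof (cases "cone b (\<lambda>ys. d (z # ys)) zs = 0")
    case True
    then show ?thesis
      using Cons.prems by (intro exI[of _ "[]"] exI[of _ zs]) (auto split: if_splits)
  next
    case False
    then obtain as bs where "zs = as @ b # bs" "d (z # as @ bs) \<noteq> 0"
      using Cons.IH by blast
    then show ?thesis
      by (intro exI[of _ "z # as"] exI[of _ bs]) auto
  qed
qed simp

lemma finite_support_cone:
  assumes "finite {xs. d xs \<noteq> 0}"
  shows "finite {zs. cone b d zs \<noteq> 0}"
proof (rule finite_subset)
  \<comment> \<open>A list in the support of the cone is determined by a list in the support of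
    \<open>d\<close> and the position at which \<open>b\<close> is inserted.\<close>
  let ?A = "SIGMA ys:{xs. d xs \<noteq> 0}. {..length ys}"
  show "finite ((\<lambda>(ys, i). take i ys @ b # drop i ys) ` ?A)"
    using assms by blast
  show "{zs. cone b d zs \<noteq> 0} \<subseteq> (\<lambda>(ys, i). take i ys @ b # drop i ys) ` ?A"
  proof
    fix zs assume "zs \<in> {zs. cone b d zs \<noteq> 0}"
    then have "cone b d zs \<noteq> 0"
      by simp
    from cone_nonzero[OF this] obtain as bs where "zs = as @ b # bs" "d (as @ bs) \<noteq> 0"
      by blast
    then show "zs \<in> (\<lambda>(ys, i). take i ys @ b # drop i ys) ` ?A"
      by (intro image_eqI[of _ _ "(as @ bs, length as)"]) auto
  qed
qed

text \<open>Unfolding the recursion twice at \<open>x # y # bs\<close> gives one term for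
  \<open>x = b\<close>, one for \<open>y = b\<close> with the opposite sign, and a cone of a doubly
  sliced \<open>d\<close>; the swap exchanges the first two and negates the third.\<close>

lemma alternating_cone:
  assumes "alternating d"
  shows "alternating (cone b d)"
proof -
  have "cone b d (as @ x # y # bs) = - cone b d (as @ y # x # bs) \<and> cone b d (as @ x # x # bs) = 0"
    for as x y bs
    using assms
  proof (induction as arbitrary: d)
    case Nil
    have "(\<lambda>ys. d (x # y # ys)) = (\<lambda>ys. - d (y # x # ys))"
      using alternating_swap_Cons[OF Nil] by blast
    moreover have "(\<lambda>ys. d (x # x # ys)) = (\<lambda>_. 0)"
      using alternatingD(2)[OF Nil, of "[]"] by auto
    ultimately show ?case
      by (auto simp: cone_uminus cone_zero)
  next
    case (Cons a as)
    then show ?case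
      using Cons.IH[OF alternating_Cons[OF Cons.prems], of a]
        alternatingD(1)[OF Cons.prems, of as x y bs] alternatingD(2)[OF Cons.prems, of as x bs] by auto
  qed
  then show ?thesis
    unfolding alternating_def by blast
qed

text \<open>The homotopy formula \<open>\<partial>(b \<and> d) = d - b \<and> \<partial>d\<close>.
  In the recursion at \<open>x # zs\<close>, summed over \<open>x\<close>, the term
  \<open>x = b\<close> yields \<open>d zs\<close> and linearity collects the rest.\<close>

lemma augmented_boundary_cone:
  assumes d: "finite {xs. d xs \<noteq> 0}"
  shows "augmented_boundary (cone b d) zs = d zs - cone b (augmented_boundary d) zs"
proof -
  obtain W where W: "finite W" "\<And>x xs. d (x # xs) \<noteq> 0 \<Longrightarrow> x \<in> W"
    using finite_support_obtain_heads[OF d] by metis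
  \<comment> \<open>The cone can have head \<open>b\<close> even if no list in the support of
    \<open>d\<close> begins with \<open>b\<close>.\<close>
  define V where "V = insert b W"
  have V: "finite V" "b \<in> V" "\<And>x xs. d (x # xs) \<noteq> 0 \<Longrightarrow> x \<in> V"
    using W by (simp_all add: V_def)
  have "augmented_boundary (cone b d) zs = (\<Sum>x\<in>V. cone b d (x # zs))"
  proof (rule augmented_boundary_eq_sum[OF V(1)])
    fix x assume nz: "cone b d (x # zs) \<noteq> 0"
    show "x \<in> V"
    proof (rule ccontr)
      assume "x \<notin> V"
      then have "x \<noteq> b" "(\<lambda>ys. d (x # ys)) = (\<lambda>_. 0)"
        using V by auto
      then show False
        using nz by (simp add: cone_zero)
    qed
  qed
  also have "\<dots> = d zs - cone b (\<lambda>ys. \<Sum>x\<in>V. d (x # ys)) zs"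
    using V by (simp add: sum_subtractf cone_sum)
  also have "(\<lambda>ys. \<Sum>x\<in>V. d (x # ys)) = augmented_boundary d"
    using V by (intro ext augmented_boundary_eq_sum[symmetric])
  finally show ?thesis .
qed

lemma pushforward_cone:
  assumes "finite {xs. d xs \<noteq> 0}"
  shows "pushforward f (cone v d) zs = cone (f v) (pushforward f d) zs"
  using assms
proof (induction zs arbitrary: d)
  case Nil
  show ?case
    by (simp add: pushforward_Nil)
next
  case (Cons z zs)
  note d = Cons.prems
  obtain W where W: "finite W" "\<And>x xs. d (x # xs) \<noteq> 0 \<Longrightarrow> x \<in> W"
    using finite_support_obtain_heads[OF d] by metis
  obtain U where U: "finite U" "\<And>x xs. cone v d (x # xs) \<noteq> 0 \<Longrightarrow> x \<in> U"
    using finite_support_obtain_heads[OF finite_support_cone[OF d, of v]] by metis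
  \<comment> \<open>One index set has to serve the slicing of both \<open>d\<close> and its cone,
    and must contain \<open>v\<close> for the head term.\<close>
  define V where "V = insert v (W \<union> U)"
  have V: "finite V" "v \<in> V" "\<And>x xs. d (x # xs) \<noteq> 0 \<Longrightarrow> x \<in> V"
    "\<And>x xs. cone v d (x # xs) \<noteq> 0 \<Longrightarrow> x \<in> V"
    using W U by (simp_all add: V_def del: cone.simps)
  let ?S = "{x\<in>V. f x = z}"
  have slice: "pushforward f (\<lambda>xs. cone v d (x # xs)) zs =
      (if x = v then pushforward f d zs else 0) - cone (f v) (pushforward f (\<lambda>xs. d (x # xs))) zs" for x
  proof -
    have "pushforward f (\<lambda>xs. cone v d (x # xs)) zs =
        pushforward f (\<lambda>xs. if x = v then d xs else 0) zs - pushforward f (cone v (\<lambda>ys. d (x # ys))) zs"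
      unfolding cone.simps by (rule pushforward_diff)
        (use d in \<open>auto intro!: finite_support_cone finite_support_Cons\<close>)
    moreover have "pushforward f (\<lambda>xs. if x = v then d xs else 0) zs = (if x = v then pushforward f d zs else 0)"
      by (simp add: pushforward_zero)
    ultimately show ?thesis
      using Cons.IH[OF finite_support_Cons[OF d]] by simp
  qed
  have "pushforward f (cone v d) (z # zs) = (\<Sum>x\<in>?S. pushforward f (\<lambda>xs. cone v d (x # xs)) zs)"
    by (rule pushforward_Cons[OF finite_support_cone[OF d] V(1,4)])
  also have "\<dots> = (\<Sum>x\<in>?S. if x = v then pushforward f d zs else 0) -
      (\<Sum>x\<in>?S. cone (f v) (pushforward f (\<lambda>xs. d (x # xs))) zs)"
    by (simp only: slice sum_subtractf)
  also have "(\<Sum>x\<in>?S. if x = v then pushforward f d zs else 0) = (if z = f v then pushforward f d zs else 0)"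
    using V by auto
  also have "(\<Sum>x\<in>?S. cone (f v) (pushforward f (\<lambda>xs. d (x # xs))) zs) =
      cone (f v) (\<lambda>ys. \<Sum>x\<in>?S. pushforward f (\<lambda>xs. d (x # xs)) ys) zs"
    by (rule cone_sum[symmetric])
  also have "(\<lambda>ys. \<Sum>x\<in>?S. pushforward f (\<lambda>xs. d (x # xs)) ys) = (\<lambda>ys. pushforward f d (z # ys))"
    by (intro ext pushforward_Cons[OF d V(1,3), symmetric])
  finally show ?case
    by simp
qed

section \<open>Moving the image of one vertex, then of all vertices\<close>

text \<open>Contracting with \<open>v\<close> and wedging with \<open>v\<close> again projects onto
  the simplices containing \<open>v\<close>. A list with two copies of \<open>v\<close> is met
  twice, but \<open>c\<close> vanishes on it.\<close>

lemma cone_slice: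
  assumes "alternating c"
  shows "cone v (\<lambda>ys. c (v # ys)) zs = (if v \<in> set zs then c zs else 0)"
  using assms
proof (induction zs arbitrary: c)
  case (Cons z zs)
  have "(\<lambda>ys. c (v # z # ys)) = (\<lambda>ys. - c (z # v # ys))"
    using alternating_swap_Cons[OF Cons.prems] by blast
  then have "cone v (\<lambda>ys. c (v # z # ys)) zs = - (if v \<in> set zs then c (z # zs) else 0)"
    using Cons.IH[OF alternating_Cons[OF Cons.prems], of z] by (simp add: cone_uminus)
  moreover have "c (v # zs) = 0" if "v \<in> set zs"
    using alternating_distinct[OF Cons.prems, of "v # zs"] that by auto
  ultimately show ?case
    by auto
qed simp

text \<open>
  Writing \<open>c = v \<and> d + e\<close> with \<open>v\<close> absent from \<open>d\<close> and \<open>e\<close>, and \<open>d'\<close>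
  for the image of \<open>d\<close>, moving the image of \<open>v\<close> from \<open>f v\<close> to \<open>b\<close> changes the image of
  \<open>c\<close> by \<open>b \<and> d' - f v \<and> d'\<close>. This is the boundary of \<open>f v \<and> b \<and> d'\<close>, because
  \<open>\<partial>c = 0\<close> forces \<open>d\<close> to be an (augmented) cycle.
\<close>

lemma pushforward_fun_upd_homologous:
  fixes f :: "'x \<Rightarrow> 'y" and c :: "'x list \<Rightarrow> 'f::field"
  assumes c: "c \<in> simplicial_chains p K" "boundary c = (\<lambda>_. 0)"
    and L: "\<And>\<sigma>. \<sigma> \<in> K \<Longrightarrow> v \<in> \<sigma> \<Longrightarrow> insert b (f ` \<sigma>) \<in> L"
  shows "(\<lambda>ys. pushforward (f(v := b)) c ys - pushforward f c ys) \<in> boundaries p L"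
proof -
  define d where "d = (\<lambda>ys. c (v # ys))"
  define e where "e xs = (if v \<in> set xs then 0 else c xs)" for xs
  define d' where "d' = pushforward f d"
  have fin: "finite {xs. c xs \<noteq> 0}" and alt: "alternating c"
    using c(1) by (simp_all add: simplicial_chains_iff_alternating)
  have fin_d: "finite {xs. d xs \<noteq> 0}"
    unfolding d_def by (rule finite_support_Cons[OF fin])
  have fin_e: "finite {xs. e xs \<noteq> 0}"
    by (rule finite_subset[OF _ fin]) (auto simp: e_def)
  have alt_d: "alternating d"
    unfolding d_def by (rule alternating_Cons[OF alt])
  have v_d: "v \<notin> set xs" if "d xs \<noteq> 0" for xs
    using alternating_distinct[OF alt, of "v # xs"] that by (simp add: d_def)
  have "c xs = cone v d xs + e xs" for xs
    using cone_slice[OF alt, of v xs] by (simp add: e_def d_def)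
  then have c_eq: "c = (\<lambda>xs. cone v d xs + e xs)"
    by blast
  have push_c: "pushforward h c ys = cone (h v) (pushforward h d) ys + pushforward h e ys" for h :: "'x \<Rightarrow> 'y" and ys
    by (subst c_eq) (simp add: pushforward_add finite_support_cone fin_d fin_e pushforward_cone)
  have d_upd: "pushforward (f(v := b)) d = d'"
    unfolding d'_def using v_d by (intro pushforward_cong_map) auto
  have e_upd: "pushforward (f(v := b)) e = pushforward f e"
    by (intro pushforward_cong_map) (auto simp: e_def split: if_splits)
  have diff: "pushforward (f(v := b)) c ys - pushforward f c ys = cone b d' ys - cone (f v) d' ys" for ys
    unfolding push_c d_upd e_upd d'_def[symmetric] by simp
  have fin_d': "finite {ys. d' ys \<noteq> 0}"
    unfolding d'_def by (rule finite_support_pushforward[OF fin_d])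
  have "augmented_boundary d ys = 0" for ys
  proof -
    \<comment> \<open>Swapping \<open>v\<close> with the summed vertex gives the sign. Since
      \<open>v # ys\<close> is nonempty, the plain cycle condition on \<open>c\<close> applies, even
      at \<open>ys = []\<close>.\<close>
    have "augmented_boundary d ys = - augmented_boundary c (v # ys)"
      unfolding augmented_boundary_def d_def
      by (simp add: alternating_swap_Cons[OF alt, of v] sum_negf)
    also have "augmented_boundary c (v # ys) = boundary c (v # ys)"
      by (simp add: boundary_augmented)
    finally show ?thesis
      by (simp add: c(2))
  qed
  then have "augmented_boundary d = (\<lambda>_. 0)"
    by blast
  then have "augmented_boundary d' = (\<lambda>_. 0)"
    by (simp add: d'_def augmented_boundary_pushforward[OF fin_d] pushforward_zero)
  then have bd_cone: "augmented_boundary (cone b d') = d'"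
    by (intro ext) (simp add: augmented_boundary_cone[OF fin_d'] cone_zero)
  \<comment> \<open>Its augmented boundary is
    \<open>b \<and> d' - f v \<and> \<partial>(b \<and> d')\<close>, and \<open>bd_cone\<close>
    turns the last factor into \<open>d'\<close>; the order of the two cones fixes the sign of the
    difference.\<close>
  let ?w = "cone (f v) (cone b d')"
  have "?w \<in> simplicial_chains (Suc p) L"
    unfolding simplicial_chains_iff_alternating
  proof (intro conjI allI impI)
    show "finite {xs. ?w xs \<noteq> 0}"
      by (intro finite_support_cone fin_d')
    show "alternating ?w"
      unfolding d'_def by (intro alternating_cone alternating_pushforward fin_d alt_d)
    fix zs assume w: "?w zs \<noteq> 0"
    from cone_nonzero[OF w] obtain as bs where zs: "zs = as @ f v # bs" "cone b d' (as @ bs) \<noteq> 0"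
      by blast
    from cone_nonzero[OF zs(2)] obtain as' bs' where zs': "as @ bs = as' @ b # bs'" "d' (as' @ bs') \<noteq> 0"
      by blast
    obtain xs where xs: "c (v # xs) \<noteq> 0" "as' @ bs' = map f xs"
      using zs'(2) unfolding d'_def d_def by (rule pushforward_nonzero)
    have "length zs = Suc (length (as @ bs))"
      using zs(1) by simp
    also have "\<dots> = Suc (Suc (length xs))"
      unfolding zs'(1) using arg_cong[OF xs(2), of length] by simp
    finally show "length zs = Suc (Suc p)"
      using simplicial_chains_support(1)[OF c(1) xs(1)] by simp
    \<comment> \<open>The vertex \<open>f v\<close> is already in the image of the simplex
      \<open>v # xs\<close> of \<open>c\<close>, so \<open>b\<close> is the only new vertex and the
      hypothesis on simplices containing \<open>v\<close> suffices.\<close>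
    have "set zs = insert (f v) (set (as @ bs))"
      using zs(1) by auto
    also have "\<dots> = insert (f v) (insert b (set (as' @ bs')))"
      unfolding zs'(1) by auto
    also have "\<dots> = insert b (f ` set (v # xs))"
      unfolding xs(2) by auto
    finally show "set zs \<in> L"
      using L[OF simplicial_chains_support(3)[OF c(1) xs(1)]] by simp
  qed
  moreover have "pushforward (f(v := b)) c ys - pushforward f c ys = boundary ?w ys" for ys
  proof (cases "ys = []")
    case False
    then show ?thesis
      by (simp add: boundary_augmented augmented_boundary_cone finite_support_cone fin_d' bd_cone diff)
  qed (simp add: boundary_def pushforward_Nil)
  ultimately show ?thesis
    unfolding boundaries_def by blast
qed

lemma pushforward_contiguous_id:
  assumes c: "c \<in> simplicial_chains p K" "boundary c = (\<lambda>_. 0)"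
    and L: "simplicial_complex L" and f: "\<forall>\<sigma>\<in>K. \<sigma> \<union> f ` \<sigma> \<in> L"
  shows "(\<lambda>ys. pushforward f c ys - c ys) \<in> boundaries p L"
proof -
  let ?f = "\<lambda>S x. if x \<in> S then f x else x"
  note sub = submodule_boundaries[OF L, of p]
  have *: "(\<lambda>ys. pushforward (?f S) c ys - c ys) \<in> boundaries p L" if "finite S" for S
    using that
  proof induction
    case empty
    show ?case
      using submodule.zero_closed[OF sub] by (simp add: pushforward_id cycle_space_simps)
  next
    case (insert v S)
    have upd: "?f (insert v S) = (?f S)(v := f v)"
      by auto
    have "(\<lambda>ys. pushforward (?f (insert v S)) c ys - pushforward (?f S) c ys) \<in> boundaries p L"
      unfolding upd
    proof (rule pushforward_fun_upd_homologous[OF c])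
      fix \<sigma> assume \<sigma>: "\<sigma> \<in> K" "v \<in> \<sigma>"
      then have "insert (f v) (?f S ` \<sigma>) \<subseteq> \<sigma> \<union> f ` \<sigma>"
        by auto
      then show "insert (f v) (?f S ` \<sigma>) \<in> L"
        using f \<sigma>(1) L unfolding simplicial_complex_def by blast
    qed
    from submodule.m_closed[OF sub this insert.IH] show ?case
      by (simp add: cycle_space_simps)
  qed
  obtain V where V: "finite V" "\<And>xs x. c xs \<noteq> 0 \<Longrightarrow> x \<in> set xs \<Longrightarrow> x \<in> V"
    using finite_support_obtain_vertices[OF simplicial_chains_finite[OF c(1)]] by metis
  \<comment> \<open>The two maps may differ outside \<open>V\<close>, where \<open>c\<close> has no
    vertices.\<close>
  have "pushforward (?f V) c = pushforward f c"
    using V(2) by (intro pushforward_cong_map) auto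
  then show ?thesis
    using *[OF V(1)] by simp
qed


section \<open>Induced maps in homology and interleavings\<close>

text \<open>The union over all representatives avoids choosing one, as in
  \<open>homology_inclusion\<close>; for a simplicial \<open>f\<close> all cosets in it
  coincide.\<close>

definition homology_map ::
    "nat \<Rightarrow> 'y set set \<Rightarrow> ('x \<Rightarrow> 'y) \<Rightarrow> ('x list \<Rightarrow> 'f::field) set \<Rightarrow> ('y list \<Rightarrow> 'f) set" where
  "homology_map p L f C = (\<Union>c\<in>C. boundaries p L +>\<^bsub>cycle_space p L\<^esub> pushforward f c)"

lemma pushforward_in_cycles:
  assumes "c \<in> carrier (cycle_space p K)" "\<forall>\<sigma>\<in>K. f ` \<sigma> \<in> L"
  shows "pushforward f c \<in> carrier (cycle_space p L)"
  using assms
  by (auto simp: cycle_space_simps boundary_pushforward simplicial_chains_finite pushforward_zero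
      intro: pushforward_in_chains)

lemma pushforward_cycle_add:
  assumes "c \<in> carrier (cycle_space p K)" "d \<in> carrier (cycle_space p K)"
  shows "pushforward f (c \<oplus>\<^bsub>cycle_space p K\<^esub> d) =
    pushforward f c \<oplus>\<^bsub>cycle_space p L\<^esub> pushforward f d"
  using assms by (auto simp: cycle_space_simps pushforward_add simplicial_chains_finite)

text \<open>Independence of the representative: pushforward commutes with the boundary, so
  boundaries go to boundaries.\<close>

lemma homology_map_class:
  assumes KL: "simplicial_complex K" "simplicial_complex L" and f: "\<forall>\<sigma>\<in>K. f ` \<sigma> \<in> L"
    and c: "c \<in> carrier (cycle_space p K)"
  shows "homology_map p L f (boundaries p K +>\<^bsub>cycle_space p K\<^esub> c) =
    boundaries p L +>\<^bsub>cycle_space p L\<^esub> pushforward f c"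
proof -
  have "boundaries p L +>\<^bsub>cycle_space p L\<^esub> pushforward f d =
      boundaries p L +>\<^bsub>cycle_space p L\<^esub> pushforward f c"
    if d: "d \<in> boundaries p K +>\<^bsub>cycle_space p K\<^esub> c" for d
  proof -
    obtain b where b: "b \<in> boundaries p K" "d = b \<oplus>\<^bsub>cycle_space p K\<^esub> c"
      using d by (auto simp: a_r_coset_def')
    obtain e where e: "e \<in> simplicial_chains (Suc p) K" "b = boundary e"
      using b(1) by (auto simp: boundaries_def)
    have "pushforward f b \<in> boundaries p L"
      unfolding e(2) boundaries_def boundary_pushforward[OF simplicial_chains_finite[OF e(1)], symmetric]
      by (intro imageI pushforward_in_chains[OF e(1) f])
    moreover have "b \<in> carrier (cycle_space p K)"
      using b(1) submodule.subset[OF submodule_boundaries[OF KL(1)]] by blast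
    ultimately show ?thesis
      unfolding b(2) pushforward_cycle_add[OF \<open>b \<in> carrier (cycle_space p K)\<close> c, of f L]
      by (intro coset_absorb[OF vectorspace_cycle_space submodule_boundaries[OF KL(2)]] pushforward_in_cycles[OF c f])
  qed
  moreover have "c \<in> boundaries p K +>\<^bsub>cycle_space p K\<^esub> c"
  proof -
    have "\<zero>\<^bsub>cycle_space p K\<^esub> \<in> boundaries p K"
      by (rule submodule.zero_closed[OF submodule_boundaries[OF KL(1)]])
    then show ?thesis
      by (force simp: a_r_coset_def' cycle_space_simps)
  qed
  ultimately show ?thesis
    unfolding homology_map_def by (intro SUP_eq_const) blast+
qed

lemma homology_map_linear:
  assumes KL: "simplicial_complex K" "simplicial_complex L" and f: "\<forall>\<sigma>\<in>K. f ` \<sigma> \<in> L"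
  shows "linear_map class_ring (homology p K) (homology p L)
    (homology_map p L f :: ('x list \<Rightarrow> 'f::field) set \<Rightarrow> ('y list \<Rightarrow> 'f) set)"
proof -
  let ?H = "homology_map p L f :: ('x list \<Rightarrow> 'f) set \<Rightarrow> ('y list \<Rightarrow> 'f) set"
  note vs = vectorspace_homology[OF KL(1)] vectorspace_homology[OF KL(2)]
  note sK = vectorspace_cycle_space submodule_boundaries[OF KL(1)]
  note sL = vectorspace_cycle_space submodule_boundaries[OF KL(2)]
  note module_cycle = vectorspace.axioms(1)[OF vectorspace_cycle_space]
  note push = pushforward_in_cycles[OF _ f]
  note cls = homology_map_class[OF KL f]
  have add: "c \<oplus>\<^bsub>cycle_space p K\<^esub> d \<in> carrier (cycle_space p K)"
    if "c \<in> carrier (cycle_space p K)" "d \<in> carrier (cycle_space p K)" for c d :: "'x list \<Rightarrow> 'f"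
    using that by (auto simp: cycle_space_simps simplicial_chains_add boundary_add simplicial_chains_finite)
  have smult: "a \<odot>\<^bsub>cycle_space p K\<^esub> c \<in> carrier (cycle_space p K)"
    if "c \<in> carrier (cycle_space p K)" for a and c :: "'x list \<Rightarrow> 'f"
    using that by (auto simp: cycle_space_simps simplicial_chains_smult boundary_smult)
  have "?H \<in> module_hom class_ring (homology p K) (homology p L)"
    unfolding module_hom_def mem_Collect_eq
  proof (intro conjI allI impI Pi_I)
    fix C :: "('x list \<Rightarrow> 'f) set" assume "C \<in> carrier (homology p K)"
    with KL(1) obtain c where c: "c \<in> carrier (cycle_space p K)"
      "C = boundaries p K +>\<^bsub>cycle_space p K\<^esub> c"
      by (rule homology_obtain)
    show "?H C \<in> carrier (homology p L)"
      unfolding c(2) cls[OF c(1)] by (rule homology_classI[OF KL(2) push[OF c(1)]])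
  next
    fix C D :: "('x list \<Rightarrow> 'f) set" assume CD: "C \<in> carrier (homology p K) \<and> D \<in> carrier (homology p K)"
    obtain c where c: "c \<in> carrier (cycle_space p K)"
      "C = boundaries p K +>\<^bsub>cycle_space p K\<^esub> c"
      using KL(1) conjunct1[OF CD] by (rule homology_obtain)
    obtain d where d: "d \<in> carrier (cycle_space p K)"
      "D = boundaries p K +>\<^bsub>cycle_space p K\<^esub> d"
      using KL(1) conjunct2[OF CD] by (rule homology_obtain)
    have "?H (C \<oplus>\<^bsub>homology p K\<^esub> D) =
        boundaries p L +>\<^bsub>cycle_space p L\<^esub> pushforward f (c \<oplus>\<^bsub>cycle_space p K\<^esub> d)"
      unfolding c(2) d(2) homology_def quotient_add[OF sK c(1) d(1)] by (rule cls[OF add[OF c(1) d(1)]])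
    also have "\<dots> = ?H C \<oplus>\<^bsub>homology p L\<^esub> ?H D"
      unfolding c(2) d(2) cls[OF c(1)] cls[OF d(1)] homology_def pushforward_cycle_add[OF c(1) d(1), of f L]
      by (rule quotient_add[OF sL push[OF c(1)] push[OF d(1)], symmetric])
    finally show "?H (C \<oplus>\<^bsub>homology p K\<^esub> D) = ?H C \<oplus>\<^bsub>homology p L\<^esub> ?H D" .
  next
    fix a :: 'f and C :: "('x list \<Rightarrow> 'f) set" assume "a \<in> carrier class_ring \<and> C \<in> carrier (homology p K)"
    then have a: "a \<in> carrier class_ring" and C: "C \<in> carrier (homology p K)"
      by blast+
    obtain c where c: "c \<in> carrier (cycle_space p K)"
      "C = boundaries p K +>\<^bsub>cycle_space p K\<^esub> c"
      using KL(1) C by (rule homology_obtain)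
    have eq: "pushforward f (a \<odot>\<^bsub>cycle_space p K\<^esub> c) = a \<odot>\<^bsub>cycle_space p L\<^esub> pushforward f c"
      by (auto simp: cycle_space_simps pushforward_smult)
    have "?H (a \<odot>\<^bsub>homology p K\<^esub> C) =
        boundaries p L +>\<^bsub>cycle_space p L\<^esub> pushforward f (a \<odot>\<^bsub>cycle_space p K\<^esub> c)"
      unfolding c(2) homology_def quotient_smult[OF sK a c(1)] by (rule cls[OF smult[OF c(1)]])
    also have "\<dots> = a \<odot>\<^bsub>homology p L\<^esub> ?H C"
      unfolding c(2) cls[OF c(1)] homology_def eq
      by (rule quotient_smult[OF sL a push[OF c(1)], symmetric])
    finally show "?H (a \<odot>\<^bsub>homology p K\<^esub> C) = a \<odot>\<^bsub>homology p L\<^esub> ?H C" .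
  qed
  then show ?thesis
    by (rule linear_map.intro[OF vs mod_hom.intro[OF vs[THEN vectorspace.axioms(1)] mod_hom_axioms.intro]])
qed

text \<open>Supplies the two composite identities of an interleaving: on a cycle, the composite
  pushforward differs from the cycle itself by a boundary in \<open>M\<close>.\<close>

lemma homology_map_comp_contiguous:
  assumes KLM: "simplicial_complex K" "simplicial_complex L" "simplicial_complex M"
    and f: "\<forall>\<sigma>\<in>K. f ` \<sigma> \<in> L" and g: "\<forall>\<sigma>\<in>L. g ` \<sigma> \<in> M"
    and gf: "\<forall>\<sigma>\<in>K. \<sigma> \<union> (\<lambda>x. g (f x)) ` \<sigma> \<in> M" and KM: "K \<subseteq> M"
    and C: "C \<in> carrier (homology p K)"
  shows "homology_map p M g (homology_map p L f C) = homology_inclusion p M C"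
proof -
  obtain c where c: "c \<in> carrier (cycle_space p K)" "C = boundaries p K +>\<^bsub>cycle_space p K\<^esub> c"
    using KLM(1) C by (rule homology_obtain)
  let ?d = "pushforward (\<lambda>x. g (f x)) c"
  have c': "c \<in> simplicial_chains p K" "boundary c = (\<lambda>_. 0)"
    using c(1) by (simp_all add: cycle_space_simps)
  have cM: "c \<in> carrier (cycle_space p M)"
    using c(1) cycle_space_mono[OF KM] by blast
  have "homology_map p M g (homology_map p L f C) = boundaries p M +>\<^bsub>cycle_space p M\<^esub> ?d"
    unfolding c(2) homology_map_class[OF KLM(1,2) f c(1)]
      homology_map_class[OF KLM(2,3) g pushforward_in_cycles[OF c(1) f]]
      pushforward_comp[OF simplicial_chains_finite[OF c'(1)]] ..
  also have "?d = (\<lambda>ys. ?d ys - c ys) \<oplus>\<^bsub>cycle_space p M\<^esub> c"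
    by (simp add: cycle_space_simps)
  also have "boundaries p M +>\<^bsub>cycle_space p M\<^esub> \<dots> = boundaries p M +>\<^bsub>cycle_space p M\<^esub> c"
    by (rule coset_absorb[OF vectorspace_cycle_space submodule_boundaries[OF KLM(3)]
        pushforward_contiguous_id[OF c' KLM(3) gf] cM])
  also have "\<dots> = homology_inclusion p M C"
    unfolding c(2) by (rule homology_inclusion_class[OF KLM(1,3) KM c(1), symmetric])
  finally show ?thesis .
qed

text \<open>Pushforward does not depend on the complex and chains of a subcomplex are chains of the
  larger one, so both paths give the class of the same cycle.\<close>

lemma homology_map_inclusion:
  assumes sc: "simplicial_complex K" "simplicial_complex K'" "simplicial_complex L" "simplicial_complex L'"
    and sub: "K \<subseteq> K'" "L \<subseteq> L'"
    and f: "\<forall>\<sigma>\<in>K. f ` \<sigma> \<in> L" "\<forall>\<sigma>\<in>K'. f ` \<sigma> \<in> L'"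
    and C: "C \<in> carrier (homology p K)"
  shows "homology_map p L' f (homology_inclusion p K' C) =
    homology_inclusion p L' (homology_map p L f C)"
proof -
  obtain c where c: "c \<in> carrier (cycle_space p K)" "C = boundaries p K +>\<^bsub>cycle_space p K\<^esub> c"
    using sc(1) C by (rule homology_obtain)
  have cK': "c \<in> carrier (cycle_space p K')"
    using c(1) cycle_space_mono[OF sub(1)] by blast
  show ?thesis
    unfolding c(2) homology_inclusion_class[OF sc(1,2) sub(1) c(1)] homology_map_class[OF sc(1,3) f(1) c(1)]
      homology_map_class[OF sc(2,4) f(2) cK']
      homology_inclusion_class[OF sc(3,4) sub(2) pushforward_in_cycles[OF c(1) f(1)]] ..
qed

section \<open>Rips complexes under a correspondence, and the distance bound\<close>

lemma rips_image:
  assumes "\<And>x. x \<in> X \<Longrightarrow> \<phi> x \<in> Y" "\<And>x x'. x \<in> X \<Longrightarrow> x' \<in> X \<Longrightarrow> g (\<phi> x) (\<phi> x') \<le> h x x' + \<epsilon>"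
    and "\<sigma> \<in> rips X h t"
  shows "\<phi> ` \<sigma> \<in> rips Y g (t + \<epsilon>)"
  using assms unfolding rips_def by auto (meson add_right_mono order_trans subsetD)

text \<open>Both \<open>x\<close> and \<open>\<psi> (\<phi> x)\<close> correspond to
  \<open>\<phi> x\<close>, so any two vertices of the union can be compared, through
  \<open>g\<close> at two such points, with two vertices of \<sigma>. Each comparison costs
  \<epsilon>.\<close>

lemma rips_contiguous:
  assumes M: "\<And>x y x' y'. (x, y) \<in> M \<Longrightarrow> (x', y') \<in> M \<Longrightarrow> \<bar>h x x' - g y y'\<bar> \<le> \<epsilon>"
    and \<phi>: "\<And>x. x \<in> X \<Longrightarrow> (x, \<phi> x) \<in> M" and \<psi>: "\<And>y. y \<in> Y \<Longrightarrow> (\<psi> y, y) \<in> M"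
    and XY: "M \<subseteq> X \<times> Y" and \<epsilon>: "0 \<le> \<epsilon>" and \<sigma>: "\<sigma> \<in> rips X h t"
  shows "\<sigma> \<union> (\<lambda>x. \<psi> (\<phi> x)) ` \<sigma> \<in> rips X h (t + 2 * \<epsilon>)"
proof -
  have \<sigma>': "finite \<sigma>" "\<sigma> \<noteq> {}" "\<sigma> \<subseteq> X" "\<And>x x'. x \<in> \<sigma> \<Longrightarrow> x' \<in> \<sigma> \<Longrightarrow> h x x' \<le> t"
    using \<sigma> by (auto simp: rips_def)
  let ?N = "\<lambda>u x. (u, \<phi> x) \<in> M"
  have N: "\<exists>x\<in>\<sigma>. ?N u x" if "u \<in> \<sigma> \<union> (\<lambda>x. \<psi> (\<phi> x)) ` \<sigma>" for u
    using that \<phi> \<psi> XY \<sigma>'(3) by blast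
  have "h u u' \<le> t + 2 * \<epsilon>"
    if u: "u \<in> \<sigma> \<union> (\<lambda>x. \<psi> (\<phi> x)) ` \<sigma>" "u' \<in> \<sigma> \<union> (\<lambda>x. \<psi> (\<phi> x)) ` \<sigma>" for u u'
  proof -
    obtain x x' where x: "x \<in> \<sigma>" "?N u x" "x' \<in> \<sigma>" "?N u' x'"
      using N[OF u(1)] N[OF u(2)] by blast
    have "\<bar>h u u' - g (\<phi> x) (\<phi> x')\<bar> \<le> \<epsilon>"
      using x by (intro M)
    moreover have "\<bar>h x x' - g (\<phi> x) (\<phi> x')\<bar> \<le> \<epsilon>"
      using x \<sigma>'(3) by (intro M \<phi>) auto
    ultimately show ?thesis
      using \<sigma>'(4)[OF x(1,3)] by linarith
  qed
  moreover have "(\<lambda>x. \<psi> (\<phi> x)) ` \<sigma> \<subseteq> X"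
    using \<phi> \<psi> XY \<sigma>'(3) by blast
  ultimately show ?thesis
    using \<sigma>' by (auto simp: rips_def)
qed

lemma rips_homology_interleaved:
  assumes M: "M \<in> correspondences X Y"
    "\<And>x y x' y'. (x, y) \<in> M \<Longrightarrow> (x', y') \<in> M \<Longrightarrow> \<bar>h x x' - g y y'\<bar> \<le> \<epsilon>"
    and \<epsilon>: "0 \<le> \<epsilon>"
  shows "interleaved \<epsilon> (rips_homology k X h :: ('f::field, _) persistence) (rips_homology k Y g)"
proof -
  have MXY: "M \<subseteq> X \<times> Y" and "\<forall>x\<in>X. \<exists>y. (x, y) \<in> M" "\<forall>y\<in>Y. \<exists>x. (x, y) \<in> M"
    using M(1) by (auto simp: correspondences_def)
  then obtain \<phi> \<psi> where \<phi>: "\<And>x. x \<in> X \<Longrightarrow> (x, \<phi> x) \<in> M" and \<psi>: "\<And>y. y \<in> Y \<Longrightarrow> (\<psi> y, y) \<in> M"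
    by metis
  have \<phi>': "\<forall>\<sigma>\<in>rips X h t. \<phi> ` \<sigma> \<in> rips Y g (t + \<epsilon>)" for t
  proof (intro ballI rips_image)
    show "\<phi> x \<in> Y" if "x \<in> X" for x
      using \<phi>[OF that] MXY by blast
    show "g (\<phi> x) (\<phi> x') \<le> h x x' + \<epsilon>" if "x \<in> X" "x' \<in> X" for x x'
      using M(2)[OF \<phi>[OF that(1)] \<phi>[OF that(2)]] by linarith
  qed
  have \<psi>': "\<forall>\<sigma>\<in>rips Y g t. \<psi> ` \<sigma> \<in> rips X h (t + \<epsilon>)" for t
  proof (intro ballI rips_image)
    show "\<psi> y \<in> X" if "y \<in> Y" for y
      using \<psi>[OF that] MXY by blast
    show "h (\<psi> y) (\<psi> y') \<le> g y y' + \<epsilon>" if "y \<in> Y" "y' \<in> Y" for y y'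
      using M(2)[OF \<psi>[OF that(1)] \<psi>[OF that(2)]] by linarith
  qed
  \<comment> \<open>The target complex is an argument of the induced maps, so the double shift must
    take the literal form used in \<open>interleaving_maps\<close>.\<close>
  have assoc: "t + \<epsilon> + \<epsilon> = t + 2 * \<epsilon>" for t
    by simp
  have \<psi>'2: "\<forall>\<sigma>\<in>rips Y g (t + \<epsilon>). \<psi> ` \<sigma> \<in> rips X h (t + 2 * \<epsilon>)" for t
    using \<psi>'[of "t + \<epsilon>"] unfolding assoc .
  have \<phi>'2: "\<forall>\<sigma>\<in>rips X h (t + \<epsilon>). \<phi> ` \<sigma> \<in> rips Y g (t + 2 * \<epsilon>)" for t
    using \<phi>'[of "t + \<epsilon>"] unfolding assoc .
  have cont: "\<forall>\<sigma>\<in>rips X h t. \<sigma> \<union> (\<lambda>x. \<psi> (\<phi> x)) ` \<sigma> \<in> rips X h (t + 2 * \<epsilon>)" for t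
    by (rule ballI, rule rips_contiguous[where M = M and g = g and Y = Y])
      (erule (1) M(2) | erule \<phi> | erule \<psi> | rule MXY \<epsilon> | assumption)+
  have cont': "\<forall>\<sigma>\<in>rips Y g t. \<sigma> \<union> (\<lambda>y. \<phi> (\<psi> y)) ` \<sigma> \<in> rips Y g (t + 2 * \<epsilon>)" for t
  proof (intro ballI rips_contiguous[where M = "M\<inverse>" and g = h and Y = X])
    show "\<bar>g y y' - h x x'\<bar> \<le> \<epsilon>" if "(y, x) \<in> M\<inverse>" "(y', x') \<in> M\<inverse>" for y x y' x'
      using M(2) that by (simp add: abs_minus_commute)
  qed (use \<phi> \<psi> MXY \<epsilon> in auto)
  note sc = simplicial_complex_rips
  define \<alpha> :: "real \<Rightarrow> ('a list \<Rightarrow> 'f) set \<Rightarrow> ('b list \<Rightarrow> 'f) set"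
    where "\<alpha> t = homology_map k (rips Y g (t + \<epsilon>)) \<phi>" for t
  define \<beta> :: "real \<Rightarrow> ('b list \<Rightarrow> 'f) set \<Rightarrow> ('a list \<Rightarrow> 'f) set"
    where "\<beta> t = homology_map k (rips X h (t + \<epsilon>)) \<psi>" for t
  have "interleaving_maps \<epsilon> (rips_homology k X h) (rips_homology k Y g) \<alpha> \<beta>"
    unfolding interleaving_maps_def rips_homology_def persistence.simps \<alpha>_def \<beta>_def
  proof (intro conjI allI impI ballI, goal_cases)
    case (1 t)
    then show ?case
      by (intro homology_map_linear sc \<phi>')
  next
    case (2 t)
    then show ?case
      by (intro homology_map_linear sc \<psi>')
  next
    case (3 t s v)
    then show ?case
      by (intro homology_map_inclusion[of "rips X h t"] sc rips_mono \<phi>') auto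
  next
    case (4 t s v)
    then show ?case
      by (intro homology_map_inclusion[of "rips Y g t"] sc rips_mono \<psi>') auto
  next
    case (5 t v)
    then show ?case
      unfolding assoc using \<epsilon>
      by (intro homology_map_comp_contiguous[of "rips X h t"] sc rips_mono \<phi>' \<psi>'2 cont) auto
  next
    case (6 t v)
    then show ?case
      unfolding assoc using \<epsilon>
      by (intro homology_map_comp_contiguous[of "rips Y g t"] sc rips_mono \<psi>' \<phi>'2 cont') auto
  qed
  then show ?thesis
    unfolding interleaved_def by blast
qed

text \<open>The factor 2 cancels the half in \<open>d_CD\<close>, so it is enough to bound
  \<open>d_int\<close> by the distortion of each correspondence.\<close>

theorem rips_homology_stability:
  "d_int (rips_homology k X h :: ('f::field, _) persistence) (rips_homology k Y g) \<le> 2 * d_CD X h Y g"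
proof -
  let ?PX = "rips_homology k X h :: ('f, _) persistence"
  let ?PY = "rips_homology k Y g :: ('f, _) persistence"
  have "d_int ?PX ?PY \<le> distortion h g M" if M: "M \<in> correspondences X Y" for M
  proof (rule ennreal_le_epsilon)
    fix e :: real assume fin: "distortion h g M < top_class.top" and e: "0 < e"
    \<comment> \<open>The distortion may be 0 while \<open>d_int\<close> ranges over strictly
      positive \<epsilon>; the slack \<open>e\<close> ensures positivity and is removed by
      \<open>ennreal_le_epsilon\<close>, which also leaves only finite distortion to treat.\<close>
    define \<epsilon> where "\<epsilon> = enn2real (distortion h g M) + e"
    have "\<bar>h x x' - g y y'\<bar> \<le> \<epsilon>" if "(x, y) \<in> M" "(x', y') \<in> M" for x y x' y'
    proof -
      have "ennreal \<bar>h x x' - g y y'\<bar> \<le> distortion h g M"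
        unfolding distortion_def using that by (auto intro!: SUP_upper2)
      also have "\<dots> = ennreal (enn2real (distortion h g M))"
        using fin by simp
      finally show ?thesis
        using e by (simp add: \<epsilon>_def)
    qed
    moreover have pos: "0 < \<epsilon>"
      using e by (simp add: \<epsilon>_def add_nonneg_pos)
    ultimately have "interleaved \<epsilon> ?PX ?PY"
      using M by (intro rips_homology_interleaved) auto
    with pos have "d_int ?PX ?PY \<le> ennreal \<epsilon>"
      unfolding d_int_def by (intro INF_lower) simp
    also have "\<dots> = distortion h g M + ennreal e"
      using fin e by (simp add: \<epsilon>_def ennreal_plus)
    finally show "d_int ?PX ?PY \<le> distortion h g M + ennreal e" .
  qed
  then have "d_int ?PX ?PY \<le> (INF M \<in> correspondences X Y. distortion h g M)"
    by (intro INF_greatest)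
  also have "\<dots> = 2 * d_CD X h Y g"
    by (simp add: d_CD_def ennreal_times_divide mult.commute[of 2] ennreal_mult_divide_eq)
  finally show ?thesis .
qed

theorem corollary10:
  fixes a :: real and k :: nat
    and X :: "'x set" and f :: "'x \<Rightarrow> 'x \<Rightarrow> real"
    and Y :: "'y set" and g :: "'y \<Rightarrow> 'y \<Rightarrow> real"
    and PX :: "('f::field, ('x list \<Rightarrow> 'f) set) persistence"
    and PY :: "('f, ('y list \<Rightarrow> 'f) set) persistence"
  assumes "a \<in> {0..1}"
    and "d_CD X f Y g < \<infinity>"
    and "PX = rips_homology k X (symmetrize a f)"
    and "PY = rips_homology k Y (symmetrize a g)"
  shows "d_int PX PY \<le> 2 * d_CD X (symmetrize a f) Y (symmetrize a g)"
  unfolding assms(3,4) by (rule rips_homology_stability)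

end
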